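(* Let $F$ be a field and let $\mathbb{O}$ be an octonion algebra over $F$. The group $\mathrm{E}_6(F)$ (defined from $F$ and $\mathbb{O}$) is simple.
   Context: An octonion algebra $\mathbb{O}$ over a field $F$ is an $8$-dimensional unital (not necessarily associative) $F$-algebra with a quadratic form $N:\mathbb{O}\to F$ whose polar form $\langle x,y\rangle=N(x+y)-N(x)-N(y)$ is non-degenerate and such that $N(xy)=N(x)N(y)$ for all $x,y\in\mathbb{O}$. Put $T(x)=\langle x,1_{\mathbb{O}}\rangle$ and $\overline{x}=T(x)\cdot 1_{\mathbb{O}}-x$, so that $x\overline{x}=N(x)\cdot 1_{\mathbb{O}}$; multiples of $1_{\mathbb{O}}$ are identified with elements of $F$. One has $T((xy)z)=T(x(yz))$ for all $x,y,z\in\mathbb{O}$, so $T(xyz)$ is unambiguous. The Albert space $\mathbb{J}$ is the $27$-dimensional $F$-space of elements $(a,b,c\mid A,B,C)$ with $a,b,c\in F\cdot 1_{\mathbb{O}}$ and $A,B,C\in\mathbb{O}$, where $(a,b,c\mid A,B,C)$ denotes the $3\times 3$ matrix with rows $(a,C,\overline{B})$, $(\overline{C},b,A)$, $(B,\overline{A},c)$. The Dickson–Freudenthal determinant is the cubic form on $\mathbb{J}$ given by $\Delta(a,b,c\mid A,B,C)=abc-aA\overline{A}-bB\overline{B}-cC\overline{C}+T(ABC)$. $\mathrm{SE}_6(F)$ is the group of all $F$-linear maps on $\mathbb{J}$ preserving $\Delta$, and $\mathrm{E}_6(F)$ is the quotient of $\mathrm{SE}_6(F)$ by its centre. *)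

theory Defs
  imports Complex_Main "HOL-Algebra.Coset" "HOL-Library.Product_Plus"
begin

text \<open>The locale \<open>simple_group\<close> of HOL-Algebra requires \<open>order G > 1\<close>, where the order of an
  infinite group is \<open>0\<close>; it therefore excludes all infinite groups and cannot be used here.\<close>

definition simple_abstract_group :: "('a, 'm) monoid_scheme \<Rightarrow> bool" where
  "simple_abstract_group G \<longleftrightarrow>
     group G \<and> carrier G \<noteq> {\<one>\<^bsub>G\<^esub>} \<and> (\<forall>H. H \<lhd> G \<longrightarrow> H = {\<one>\<^bsub>G\<^esub>} \<or> H = carrier G)"

definition centre :: "('a, 'm) monoid_scheme \<Rightarrow> 'a set" where
  "centre G = {z \<in> carrier G. \<forall>g \<in> carrier G. z \<otimes>\<^bsub>G\<^esub> g = g \<otimes>\<^bsub>G\<^esub> z}"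

definition polar :: "('v::ab_group_add \<Rightarrow> 'f::field) \<Rightarrow> 'v \<Rightarrow> 'v \<Rightarrow> 'f" where
  "polar N x y = N (x + y) - N x - N y"

text \<open>The polar form is symmetric, so linearity in the first argument is bilinearity.\<close>

definition quadratic_form ::
    "('f::field \<Rightarrow> 'v::ab_group_add \<Rightarrow> 'v) \<Rightarrow> ('v \<Rightarrow> 'f) \<Rightarrow> bool" where
  "quadratic_form scale N \<longleftrightarrow>
     (\<forall>k x. N (scale k x) = k\<^sup>2 * N x) \<and>
     (\<forall>y. Vector_Spaces.linear scale (*) (\<lambda>x. polar N x y))"

locale octonion_algebra = vector_space scale
  for scale :: "'f::field \<Rightarrow> 'o::ab_group_add \<Rightarrow> 'o" (infixr \<open>\<cdot>\<close> 75) +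
  fixes omul :: "'o \<Rightarrow> 'o \<Rightarrow> 'o" (infixl \<open>\<star>\<close> 70)
    and unit :: 'o
    and N :: "'o \<Rightarrow> 'f"
  assumes dim_eq_8: "dim UNIV = 8"
    and linear_omul_right: "Vector_Spaces.linear scale scale (\<lambda>y. x \<star> y)"
    and linear_omul_left: "Vector_Spaces.linear scale scale (\<lambda>x. x \<star> y)"
    and unit_left: "unit \<star> x = x"
    and unit_right: "x \<star> unit = x"
    and quadratic_form_N: "quadratic_form scale N"
    and polar_nondegenerate: "(\<And>y. polar N x y = 0) \<Longrightarrow> x = 0"
    and N_omul: "N (x \<star> y) = N x * N y"

text \<open>\<open>(a, b, c, A, B, C)\<close> stands for the matrix with rows \<open>(a, C, oconj B)\<close>, \<open>(oconj C, b, A)\<close>,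
  \<open>(B, oconj A, c)\<close>, where \<open>oconj\<close> is octonion conjugation; the diagonal entries, which are multiples
  of the unit, are recorded as scalars.\<close>

type_synonym ('f, 'o) albert = "'f \<times> 'f \<times> 'f \<times> 'o \<times> 'o \<times> 'o"

context octonion_algebra
begin

definition T :: "'o \<Rightarrow> 'f" where
  "T x = polar N x unit"

definition oconj :: "'o \<Rightarrow> 'o" where
  "oconj x = T x \<cdot> unit - x"

definition albert_scale :: "'f \<Rightarrow> ('f, 'o) albert \<Rightarrow> ('f, 'o) albert" where
  "albert_scale k = (\<lambda>(a, b, c, A, B, C). (k * a, k * b, k * c, k \<cdot> A, k \<cdot> B, k \<cdot> C))"

text \<open>The terms \<open>a * N A\<close> are the products \<open>a \<cdot> (A \<star> oconj A)\<close> read as scalars; see \<open>albert_det_unit\<close>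
  below, and \<open>T_assoc\<close> for the bracketing in the last term.\<close>

definition albert_det :: "('f, 'o) albert \<Rightarrow> 'f" where
  "albert_det = (\<lambda>(a, b, c, A, B, C).
     a * b * c - a * N A - b * N B - c * N C + T ((A \<star> B) \<star> C))"

text \<open>Invertibility is not required explicitly: \<open>group_SE6\<close> shows that it is automatic.\<close>

definition SE6 :: "(('f, 'o) albert \<Rightarrow> ('f, 'o) albert) monoid" where
  "SE6 = \<lparr>carrier = {g. Vector_Spaces.linear albert_scale albert_scale g
                        \<and> (\<forall>X. albert_det (g X) = albert_det X)},
          mult = (\<circ>), one = id\<rparr>"

definition E6 :: "(('f, 'o) albert \<Rightarrow> ('f, 'o) albert) set monoid" where
  "E6 = SE6 Mod centre SE6"

lemma polar_commute: "polar N x y = polar N y x"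
  by (simp add: polar_def add.commute)

lemma polar_linear: "Vector_Spaces.linear scale (*) (\<lambda>x. polar N x y)"
  using quadratic_form_N by (simp add: quadratic_form_def)

lemma polar_add_left: "polar N (x + x') y = polar N x y + polar N x' y"
  and polar_diff_left: "polar N (x - x') y = polar N x y - polar N x' y"
  and polar_scale_left: "polar N (k \<cdot> x) y = k * polar N x y"
proof -
  interpret Vector_Spaces.linear scale "(*)" "\<lambda>x. polar N x y" by (rule polar_linear)
  show "polar N (x + x') y = polar N x y + polar N x' y" by (rule add)
  show "polar N (x - x') y = polar N x y - polar N x' y" by (rule diff)
  show "polar N (k \<cdot> x) y = k * polar N x y" by (rule scale)
qed

lemma polar_add_right: "polar N y (x + x') = polar N y x + polar N y x'"
  and polar_diff_right: "polar N y (x - x') = polar N y x - polar N y x'"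
  and polar_scale_right: "polar N y (k \<cdot> x) = k * polar N y x"
  by (simp_all add: polar_commute[of y] polar_add_left polar_diff_left polar_scale_left)

lemma omul_add_right: "x \<star> (y + y') = x \<star> y + x \<star> y'"
  and omul_diff_right: "x \<star> (y - y') = x \<star> y - x \<star> y'"
  and omul_scale_right: "x \<star> (k \<cdot> y) = k \<cdot> (x \<star> y)"
proof -
  interpret Vector_Spaces.linear scale scale "\<lambda>y. x \<star> y" by (rule linear_omul_right)
  show "x \<star> (y + y') = x \<star> y + x \<star> y'" by (rule add)
  show "x \<star> (y - y') = x \<star> y - x \<star> y'" by (rule diff)
  show "x \<star> (k \<cdot> y) = k \<cdot> (x \<star> y)" by (rule scale)
qed

lemma omul_add_left: "(x + x') \<star> y = x \<star> y + x' \<star> y"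
  and omul_diff_left: "(x - x') \<star> y = x \<star> y - x' \<star> y"
  and omul_scale_left: "(k \<cdot> x) \<star> y = k \<cdot> (x \<star> y)"
proof -
  interpret Vector_Spaces.linear scale scale "\<lambda>x. x \<star> y" by (rule linear_omul_left)
  show "(x + x') \<star> y = x \<star> y + x' \<star> y" by (rule add)
  show "(x - x') \<star> y = x \<star> y - x' \<star> y" by (rule diff)
  show "(k \<cdot> x) \<star> y = k \<cdot> (x \<star> y)" by (rule scale)
qed

lemma polar_omul_left_same: "polar N (x \<star> y) (x \<star> z) = N x * polar N y z"
  unfolding polar_def by (simp add: omul_add_right[symmetric] N_omul algebra_simps)

lemma polar_omul_right_same: "polar N (x \<star> y) (z \<star> y) = polar N x z * N y"
  unfolding polar_def by (simp add: omul_add_left[symmetric] N_omul algebra_simps)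

lemma polar_omul_linearized:
  "polar N (x \<star> y) (w \<star> z) + polar N (w \<star> y) (x \<star> z) = polar N x w * polar N y z"
proof -
  have "N (x + w) = polar N x w + N x + N w" by (simp add: polar_def)
  moreover have "polar N ((x + w) \<star> y) ((x + w) \<star> z) = N (x + w) * polar N y z"
    by (rule polar_omul_left_same)
  ultimately show ?thesis
    by (simp add: omul_add_left polar_add_left polar_add_right polar_omul_left_same algebra_simps)
qed

lemma polar_eqI: "(\<And>z. polar N x z = polar N y z) \<Longrightarrow> x = y"
  using polar_nondegenerate[of "x - y"] by (simp add: polar_diff_left)

lemma omul_conj: "x \<star> oconj x = N x \<cdot> unit"
proof (rule polar_eqI)
  fix z
  have "polar N (x \<star> x) z + polar N x (x \<star> z) = T x * polar N x z"
    using polar_omul_linearized[of x x unit z] by (simp add: unit_left T_def)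
  moreover have "polar N x (x \<star> z) = N x * polar N unit z"
    using polar_omul_left_same[of x unit z] by (simp add: unit_right)
  ultimately show "polar N (x \<star> oconj x) z = polar N (N x \<cdot> unit) z"
    by (simp add: oconj_def omul_diff_right omul_scale_right unit_right
        polar_diff_left polar_scale_left algebra_simps)
qed

lemma polar_omul_adjoint_left: "polar N (x \<star> y) z = polar N y (oconj x \<star> z)"
  using polar_omul_linearized[of x y unit z]
  by (simp add: unit_left oconj_def T_def omul_diff_left omul_scale_left
      polar_diff_right polar_scale_right algebra_simps)

lemma polar_omul_adjoint_right: "polar N (x \<star> y) z = polar N x (z \<star> oconj y)"
  using polar_omul_linearized[of x y z unit] polar_commute[of "z \<star> y" x]
  by (simp add: unit_right oconj_def T_def omul_diff_right omul_scale_right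
      polar_diff_right polar_scale_right algebra_simps)

lemma T_assoc: "T ((x \<star> y) \<star> z) = T (x \<star> (y \<star> z))"
proof -
  have "T ((x \<star> y) \<star> z) = polar N (x \<star> y) (oconj z)"
    by (simp add: T_def polar_omul_adjoint_right[of "x \<star> y"] unit_left)
  also have "\<dots> = polar N y (oconj x \<star> oconj z)"
    by (rule polar_omul_adjoint_left)
  also have "\<dots> = polar N (y \<star> z) (oconj x)"
    by (simp add: polar_omul_adjoint_right[of y])
  also have "\<dots> = T (x \<star> (y \<star> z))"
    by (simp add: T_def polar_omul_adjoint_left[of x] unit_right)
  finally show ?thesis .
qed

lemma albert_det_unit:
  "albert_det (a, b, c, A, B, C) \<cdot> unit =
     (a * b * c) \<cdot> unit - a \<cdot> (A \<star> oconj A) - b \<cdot> (B \<star> oconj B) - c \<cdot> (C \<star> oconj C)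
     + T ((A \<star> B) \<star> C) \<cdot> unit"
  by (simp add: albert_det_def omul_conj scale_left_distrib scale_left_diff_distrib)

lemma vector_space_albert: "vector_space albert_scale"
  by unfold_locales
    (auto simp: albert_scale_def scale_right_distrib scale_left_distrib distrib_left distrib_right)

lemma albert_det_radical:
  assumes "\<And>w. albert_det (w + z) = albert_det w"
  shows "z = 0"
proof -
  obtain a b c A B C where z: "z = (a, b, c, A, B, C)" by (cases z)
  have N0: "N 0 = 0" using N_omul[of 0 0] quadratic_form_N
    by (metis quadratic_form_def mult_zero_left power_zero_numeral scale_zero_left)
  have om0: "0 \<star> x = 0" "x \<star> 0 = 0" for x
    using omul_diff_left[of 0 0 x] omul_diff_right[of x 0 0] by simp_all
  have T0: "T 0 = 0" using polar_diff_left[of 0 0 unit] by (simp add: T_def)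
  have D: "albert_det ((p, q, r, X, Y, Z) + (a, b, c, A, B, C)) = albert_det (p, q, r, X, Y, Z)"
    for p q r X Y Z using assms unfolding z .
  note S = albert_det_def N0 om0 T0 algebra_simps
  have "a = 0" using D[of 0 1 1 0 0 0] D[of 0 1 0 0 0 0] D[of 0 0 1 0 0 0] D[of 0 0 0 0 0 0]
    by (simp add: S)
  moreover have "b = 0" using D[of 1 0 1 0 0 0] D[of 1 0 0 0 0 0] D[of 0 0 1 0 0 0] D[of 0 0 0 0 0 0]
    by (simp add: S)
  moreover have "c = 0" using D[of 1 1 0 0 0 0] D[of 1 0 0 0 0 0] D[of 0 1 0 0 0 0] D[of 0 0 0 0 0 0]
    by (simp add: S)
  moreover have "A = 0"
  proof (rule polar_nondegenerate)
    fix X show "polar N A X = 0"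
      using D[of 1 0 0 X 0 0] D[of 0 0 0 X 0 0] D[of 1 0 0 0 0 0] D[of 0 0 0 0 0 0]
      unfolding polar_def by (simp add: S)
  qed
  moreover have "B = 0"
  proof (rule polar_nondegenerate)
    fix X show "polar N B X = 0"
      using D[of 0 1 0 0 X 0] D[of 0 0 0 0 X 0] D[of 0 1 0 0 0 0] D[of 0 0 0 0 0 0]
      unfolding polar_def by (simp add: S)
  qed
  moreover have "C = 0"
  proof (rule polar_nondegenerate)
    fix X show "polar N C X = 0"
      using D[of 0 0 1 0 0 X] D[of 0 0 0 0 0 X] D[of 0 0 1 0 0 0] D[of 0 0 0 0 0 0]
      unfolding polar_def by (simp add: S)
  qed
  ultimately show ?thesis by (simp add: z zero_prod_def)
qed

lemma finite_dimensional_albert: "\<exists>S. finite_dimensional_vector_space albert_scale S"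
proof -
  interpret J: vector_space albert_scale by (rule vector_space_albert)
  obtain B where B: "independent B" "span B = UNIV" "card B = 8"
    using basis_exists[of UNIV] dim_eq_8 by (metis span_UNIV span_eq top.extremum_uniqueI)
  have finB: "finite B" using B(3) card.infinite by fastforce
  define e1 e2 e3 :: "'o \<Rightarrow> ('f, 'o) albert"
    where "e1 = (\<lambda>v. (0, 0, 0, v, 0, 0))"
      and "e2 = (\<lambda>v. (0, 0, 0, 0, v, 0))"
      and "e3 = (\<lambda>v. (0, 0, 0, 0, 0, v))"
  define D :: "('f, 'o) albert set"
    where "D = {(1, 0, 0, 0, 0, 0), (0, 1, 0, 0, 0, 0), (0, 0, 1, 0, 0, 0)}"
  define S where "S = D \<union> e1 ` B \<union> e2 ` B \<union> e3 ` B"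
  have lin: "Vector_Spaces.linear scale albert_scale e1"
    "Vector_Spaces.linear scale albert_scale e2" "Vector_Spaces.linear scale albert_scale e3"
    by (unfold_locales; simp add: e1_def e2_def e3_def albert_scale_def
        scale_right_distrib scale_left_distrib)+
  have sp: "e v \<in> J.span S"
    if "Vector_Spaces.linear scale albert_scale e" "e ` B \<subseteq> S" for e v
  proof -
    interpret vector_space_pair scale albert_scale by unfold_locales
    have "J.span (e ` B) = e ` span B" using that(1) by (rule linear_span_image)
    then have "e v \<in> J.span (e ` B)" using B(2) by simp
    then show ?thesis using J.span_mono[OF that(2)] by blast
  qed
  have "x \<in> J.span S" for x
  proof -
    obtain a b c X Y Z where x: "x = (a, b, c, X, Y, Z)" by (cases x)
    have "x = albert_scale a (1, 0, 0, 0, 0, 0) + albert_scale b (0, 1, 0, 0, 0, 0)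
        + albert_scale c (0, 0, 1, 0, 0, 0) + e1 X + e2 Y + e3 Z"
      by (simp add: x albert_scale_def e1_def e2_def e3_def)
    moreover have "e1 X \<in> J.span S" "e2 Y \<in> J.span S" "e3 Z \<in> J.span S"
      by (rule sp[OF lin(1)] sp[OF lin(2)] sp[OF lin(3)]; auto simp: S_def)+
    moreover have "d \<in> J.span S" if "d \<in> D" for d
      using that by (intro J.span_base) (simp add: S_def)
    ultimately show ?thesis
      by (auto simp: D_def intro!: J.span_add J.span_scale)
  qed
  then have S: "J.span S = UNIV" by blast
  have finS: "finite S" by (simp add: S_def D_def finB)
  obtain S' where "S' \<subseteq> S" "J.independent S'" "S \<subseteq> J.span S'"
    using J.maximal_independent_subset[of S] by blast
  moreover from this have "J.span S' = UNIV"
    using S J.span_minimal[OF _ J.subspace_span] by blast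
  ultimately show ?thesis
    using finS finite_subset by (intro exI[of _ S'], unfold_locales) auto
qed

lemma SE6_bij:
  assumes "g \<in> carrier SE6"
  shows "bij g"
proof -
  obtain S where "finite_dimensional_vector_space albert_scale S"
    using finite_dimensional_albert by blast
  then interpret J: finite_dimensional_vector_space albert_scale S .
  from assms interpret g: Vector_Spaces.linear albert_scale albert_scale g
    by (simp add: SE6_def)
  have det: "albert_det (g X) = albert_det X" for X using assms by (cases X) (simp add: SE6_def)
  have "x = y" if "g x = g y" for x y
  proof -
    have "albert_det (w + (x - y)) = albert_det w" for w
      using det[of "w + (x - y)"] det[of w] that by (simp add: g.add g.diff)
    then show ?thesis using albert_det_radical[of "x - y"] by simp
  qed
  then have "inj g" by (simp add: inj_def)
  then show ?thesis
    using J.linear_inj_imp_surj[OF g.linear_axioms] by (simp add: bij_def)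
qed

lemma group_SE6: "group SE6"
proof (rule groupI)
  show "\<one>\<^bsub>SE6\<^esub> \<in> carrier SE6"
    using vector_space.linear_id[OF vector_space_albert] by (simp add: SE6_def)
  fix g assume g: "g \<in> carrier SE6"
  then interpret g: Vector_Spaces.linear albert_scale albert_scale g
    by (simp add: SE6_def)
  have det: "albert_det (g X) = albert_det X" for X using g by (cases X) (simp add: SE6_def)
  show "\<one>\<^bsub>SE6\<^esub> \<otimes>\<^bsub>SE6\<^esub> g = g" by (simp add: SE6_def)
  have bij: "bij g" using g by (rule SE6_bij)
  have inv: "g (inv_into UNIV g x) = x" for x using bij by (simp add: bij_is_surj surj_f_inv_f)
  have eq: "inv_into UNIV g y = x" if "y = g x" for x y
    using bij that by (simp add: bij_is_inj)
  have "Vector_Spaces.linear albert_scale albert_scale (inv_into UNIV g)"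
    by unfold_locales (rule eq; simp add: g.add g.scale inv)+
  moreover have "albert_det (inv_into UNIV g X) = albert_det X" for X
    using det[of "inv_into UNIV g X"] by (simp add: inv)
  ultimately have "inv_into UNIV g \<in> carrier SE6" by (simp add: SE6_def)
  moreover have "inv_into UNIV g \<otimes>\<^bsub>SE6\<^esub> g = \<one>\<^bsub>SE6\<^esub>"
    using bij by (simp add: SE6_def bij_is_inj)
  ultimately show "\<exists>h\<in>carrier SE6. h \<otimes>\<^bsub>SE6\<^esub> g = \<one>\<^bsub>SE6\<^esub>" by blast
  fix h assume h: "h \<in> carrier SE6"
  show "g \<otimes>\<^bsub>SE6\<^esub> h \<in> carrier SE6"
    using g h Vector_Spaces.linear_compose[of albert_scale albert_scale h albert_scale g]
    by (simp add: SE6_def del: split_paired_All)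
  fix k
  show "g \<otimes>\<^bsub>SE6\<^esub> h \<otimes>\<^bsub>SE6\<^esub> k = g \<otimes>\<^bsub>SE6\<^esub> (h \<otimes>\<^bsub>SE6\<^esub> k)"
    by (simp add: SE6_def comp_assoc)
qed

end

end

theory Submission
  imports Defs "HOL-Algebra.Zassenhaus"
begin

text \<open>Iwasawa's argument is applied to the action of the isometry group of the determinant on the
  white points, the lines spanned by vectors of rank one such as the first diagonal idempotent
  \<open>e1\<close>. Three facts enter.

  The stabilizer of the line of \<open>e1\<close> is a maximal subgroup (\<open>line_stabilizer_maximal\<close>): an isometry
  outside it can be corrected, inside the subgroup it generates with the stabilizer, to one that
  exchanges two idempotents, and then all root elements are available.

  This stabilizer normalizes an abelian group, its unipotent radical (\<open>unipotent_conj\<close>,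
  \<open>unipotent_eq_roots\<close>, \<open>unipotent_commute\<close>).

  The whole group is generated, as a normal subgroup, by the commutators of an element of this
  radical with a conjugate of another (\<open>normal_contains_commutators\<close>).

  Given a normal subgroup \<open>K\<close>, either \<open>K\<close> stabilizes the line of \<open>e1\<close>, hence every white point,
  and consists of scalars; or \<open>K\<close> and the stabilizer generate everything, modulo \<open>K\<close> all conjugates
  of the radical coincide with the radical itself, the commutators above become trivial, and \<open>K\<close> is
  the whole group (\<open>iwasawa\<close>, \<open>normal_subgroup_SE6\<close>).

  The bulk of the work is \<open>isometry_elementary\<close>: every isometry is a product of root elements, the
  analogues of elementary 3 by 3 matrices acting by congruence. Root elements bring the images of
  the three diagonal idempotents back to the lines of the idempotents. What remains is a diagonal
  isometry, given by three similitudes of the norm that are related by triality. Products of three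
  root elements lift the reflections of the norm form (\<open>lifted_reflection_apply\<close>), and since
  reflections generate the orthogonal group (\<open>orthogonal_imp_reflection_product\<close>), the third
  similitude can be reduced to the identity. An odd number of reflections would then make the
  octonions commutative. An even number leaves \<open>A \<mapsto> A k\<close>, \<open>B \<mapsto> k\<inverse> B\<close> with \<open>k\<close> in the nucleus; the
  nucleus consists of scalars (\<open>nucleus_imp_scalar\<close>), and for scalar \<open>k\<close> this map is a product of two
  lifted reflections.

  The field is arbitrary and the octonions may be split or a division algebra, so nothing may be
  divided by 2, and over the field with two elements the homogeneous parts of a cubic function
  cannot be separated by scaling. For this reason rank one is expressed by the trilinear
  polarization of the determinant alone (\<open>white\<close>). Where nonisotropic octonions are needed, they come
  from counting dimensions in orthogonal complements (\<open>exists_nonisotropic_perp\<close>).\<close>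

section \<open>Iwasawa's criterion\<close>

text \<open>Modulo \<open>K\<close> the element \<open>h\<close> equals \<open>w\<close>, which commutes with \<open>u\<close>. The proof exhibits the
  commutator as a product of conjugates of \<open>k\<close> and its inverse.\<close>

lemma (in group) conj_commutator_mem_normal:
  assumes K: "K \<lhd> G" and k: "k \<in> K" and u: "u \<in> carrier G" and w: "w \<in> carrier G"
    and uw: "u \<otimes> w = w \<otimes> u" and h: "h = k \<otimes> w \<otimes> inv k"
  shows "u \<otimes> h \<otimes> inv u \<otimes> inv h \<in> K"
proof -
  interpret K: normal K G by (rule K)
  have c [simp]: "k \<in> carrier G" using k by (rule K.mem_carrier)
  note [simp] = u w
  have cancel: "inv x \<otimes> (x \<otimes> y) = y" "x \<otimes> (inv x \<otimes> y) = y"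
    if "x \<in> carrier G" "y \<in> carrier G" for x y
    using that by (simp_all add: m_assoc[symmetric])
  have "(u \<otimes> k \<otimes> inv u) \<otimes> ((u \<otimes> w) \<otimes> inv k \<otimes> inv (u \<otimes> w)) \<otimes> ((w \<otimes> k \<otimes> inv w) \<otimes> inv k) \<in> K"
    by (intro K.m_closed K.inv_op_closed2 K.m_inv_closed k) simp_all
  also have "(u \<otimes> k \<otimes> inv u) \<otimes> ((u \<otimes> w) \<otimes> inv k \<otimes> inv (u \<otimes> w)) \<otimes> ((w \<otimes> k \<otimes> inv w) \<otimes> inv k)
      = u \<otimes> h \<otimes> inv u \<otimes> inv h"
  proof -
    have "inv (u \<otimes> w) = inv u \<otimes> inv w" by (simp add: uw inv_mult_group)
    then show ?thesis by (simp add: h m_assoc cancel inv_mult_group)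
  qed
  finally show ?thesis .
qed

text \<open>Maximality leaves two possibilities for \<open>K <#> P\<close>. If it is the whole group, write a conjugating
  element as \<open>k \<otimes> p\<close>: the factor \<open>p\<close> maps \<open>U\<close> to itself, so each conjugate of an element of \<open>U\<close>
  is congruent modulo \<open>K\<close> to an element of \<open>U\<close>, and \<open>U\<close> is abelian. The premise \<open>gen\<close> takes the place
  of perfectness together with generation by the conjugates of \<open>U\<close>.\<close>

lemma (in group) iwasawa:
  assumes P: "subgroup P G"
    and max: "\<And>M. subgroup M G \<Longrightarrow> P \<subseteq> M \<Longrightarrow> M \<subseteq> P \<or> M = carrier G"
    and U: "U \<subseteq> carrier G" and comm: "\<And>u v. u \<in> U \<Longrightarrow> v \<in> U \<Longrightarrow> u \<otimes> v = v \<otimes> u"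
    and stable: "\<And>p u. p \<in> P \<Longrightarrow> u \<in> U \<Longrightarrow> p \<otimes> u \<otimes> inv p \<in> U"
    and gen: "\<And>H. H \<lhd> G \<Longrightarrow> (\<And>u v g. u \<in> U \<Longrightarrow> v \<in> U \<Longrightarrow> g \<in> carrier G \<Longrightarrow>
      u \<otimes> (g \<otimes> v \<otimes> inv g) \<otimes> inv u \<otimes> inv (g \<otimes> v \<otimes> inv g) \<in> H) \<Longrightarrow> H = carrier G"
    and K: "K \<lhd> G"
  shows "K \<subseteq> P \<or> K = carrier G"
proof -
  interpret K: normal K G by (rule K)
  interpret P: subgroup P G by (rule P)
  have "subgroup (K <#> P) G" by (rule mult_norm_subgroup[OF K P])
  moreover have "P \<subseteq> K <#> P"
  proof
    fix p assume p: "p \<in> P"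
    then have "p = \<one> \<otimes> p" by simp
    then show "p \<in> K <#> P" unfolding set_mult_def using p K.one_closed by blast
  qed
  ultimately consider "K <#> P \<subseteq> P" | "K <#> P = carrier G" using max by blast
  then show ?thesis
  proof cases
    case 1
    have "k \<in> P" if k: "k \<in> K" for k
    proof -
      have "k = k \<otimes> \<one>" using k by simp
      then have "k \<in> K <#> P" unfolding set_mult_def using k P.one_closed by blast
      then show ?thesis using 1 by blast
    qed
    then show ?thesis by blast
  next
    case 2
    have "K = carrier G"
    proof (rule gen[OF K])
      fix u v g assume u: "u \<in> U" and v: "v \<in> U" and g: "g \<in> carrier G"
      have "g \<in> K <#> P" using g 2 by simp
      then obtain k p where kp: "k \<in> K" "p \<in> P" "g = k \<otimes> p" unfolding set_mult_def by blast
      let ?w = "p \<otimes> v \<otimes> inv p"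
      have w: "?w \<in> U" by (rule stable[OF kp(2) v])
      have "g \<otimes> v \<otimes> inv g = k \<otimes> ?w \<otimes> inv k"
        using kp v U by (simp add: m_assoc inv_mult_group subset_iff)
      then show "u \<otimes> (g \<otimes> v \<otimes> inv g) \<otimes> inv u \<otimes> inv (g \<otimes> v \<otimes> inv g) \<in> K"
        using conj_commutator_mem_normal[OF K kp(1) _ _ comm[OF u w]] u w U by blast
    qed
    then show ?thesis by blast
  qed
qed

lemma (in group) centre_normal: "centre G \<lhd> G"
proof -
  have sub: "subgroup (centre G) G"
  proof
    show "centre G \<subseteq> carrier G" by (auto simp: centre_def)
    show "\<one> \<in> centre G" by (simp add: centre_def)
    fix x y assume x: "x \<in> centre G" and y: "y \<in> centre G"
    then have c: "x \<in> carrier G" "y \<in> carrier G" by (auto simp: centre_def)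
    have "(x \<otimes> y) \<otimes> g = g \<otimes> (x \<otimes> y)" if g: "g \<in> carrier G" for g
    proof -
      have "(x \<otimes> y) \<otimes> g = x \<otimes> (g \<otimes> y)" using y g c by (simp add: centre_def m_assoc)
      also have "\<dots> = (g \<otimes> x) \<otimes> y" using x g c by (simp add: centre_def m_assoc[symmetric])
      finally show ?thesis using g c by (simp add: m_assoc)
    qed
    then show "x \<otimes> y \<in> centre G" using c by (simp add: centre_def)
  next
    fix x assume x: "x \<in> centre G"
    then have c: "x \<in> carrier G" by (simp add: centre_def)
    have "inv x \<otimes> g = g \<otimes> inv x" if g: "g \<in> carrier G" for g
    proof -
      have "x \<otimes> (g \<otimes> inv x) = g"
        using x g c by (simp add: centre_def m_assoc[symmetric]) (simp add: m_assoc)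
      then show ?thesis using g c by (metis inv_closed inv_solve_left m_closed)
    qed
    then show "inv x \<in> centre G" using c by (simp add: centre_def)
  qed
  moreover have "x \<otimes> h \<otimes> inv x \<in> centre G" if "x \<in> carrier G" "h \<in> centre G" for x h
  proof -
    have "x \<otimes> h \<otimes> inv x = h"
      using that by (simp add: centre_def) (metis inv_solve_right m_closed)
    then show ?thesis using that by simp
  qed
  ultimately show ?thesis by (simp add: normal_inv_iff)
qed

lemma (in group) simple_mod_centre:
  assumes nab: "\<exists>x\<in>carrier G. x \<notin> centre G"
    and simple: "\<And>K. K \<lhd> G \<Longrightarrow> K \<subseteq> centre G \<or> K = carrier G"
  shows "simple_abstract_group (G Mod centre G)"
proof -
  interpret Z: normal "centre G" G by (rule centre_normal)
  have one: "\<one>\<^bsub>G Mod centre G\<^esub> = centre G" by simp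
  have triv: "centre G #> x = centre G \<longleftrightarrow> x \<in> centre G" if "x \<in> carrier G" for x
    using coset_join1[OF _ that Z.is_subgroup] coset_join2[OF that Z.is_subgroup] by (rule iffI)
  have nontrivial: "carrier (G Mod centre G) \<noteq> {\<one>\<^bsub>G Mod centre G\<^esub>}"
  proof
    assume *: "carrier (G Mod centre G) = {\<one>\<^bsub>G Mod centre G\<^esub>}"
    obtain x where x: "x \<in> carrier G" "x \<notin> centre G" using nab by blast
    have "centre G #> x \<in> carrier (G Mod centre G)"
      using x(1) rcosetsI[OF Z.subset] by (simp add: FactGroup_def)
    then have "centre G #> x = centre G" unfolding * by simp
    then show False using triv[OF x(1)] x(2) by simp
  qed
  have "H = {\<one>\<^bsub>G Mod centre G\<^esub>} \<or> H = carrier (G Mod centre G)"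
    if H: "H \<lhd> G Mod centre G" for H
  proof -
    have sub: "subgroup H (G Mod centre G)" using H by (rule normal_imp_subgroup)
    have H_eq: "\<Union>H = {x \<in> carrier G. centre G #> x \<in> H}"
      by (rule Z.factgroup_subgroup_union_char[OF sub])
    have Hc: "H \<subseteq> carrier (G Mod centre G)" by (rule subgroup.subset[OF sub])
    have one_H: "centre G \<in> H" using subgroup.one_closed[OF sub] by simp
    have rep: "\<exists>x\<in>carrier G. h = centre G #> x" if "h \<in> carrier (G Mod centre G)" for h
      using that by (auto simp: FactGroup_def RCOSETS_def)
    consider "\<Union>H \<subseteq> centre G" | "\<Union>H = carrier G"
      using simple[OF Z.factgroup_subgroup_union_normal[OF H]] by blast
    then show ?thesis
    proof cases
      case 1
      have "h = centre G" if h: "h \<in> H" for h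
      proof -
        obtain x where x: "x \<in> carrier G" "h = centre G #> x" using rep[OF subsetD[OF Hc h]] by (elim bexE)
        then have "x \<in> \<Union>H" unfolding H_eq using h by simp
        then have "x \<in> centre G" using 1 by blast
        then show ?thesis using triv[OF x(1)] x(2) by simp
      qed
      then have "H \<subseteq> {centre G}" by (intro subsetI) (simp only: singleton_iff)
      then have "H = {centre G}" using one_H by blast
      then show ?thesis unfolding one by (rule disjI1)
    next
      case 2
      have "h \<in> H" if h: "h \<in> carrier (G Mod centre G)" for h
      proof -
        obtain x where x: "x \<in> carrier G" "h = centre G #> x" using rep[OF h] by (elim bexE)
        have "x \<in> \<Union>H" unfolding 2 by (rule x(1))
        then show ?thesis unfolding H_eq x(2) by simp
      qed
      then have "H = carrier (G Mod centre G)" using Hc by (intro equalityI subsetI) blast+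
      then show ?thesis by (rule disjI2)
    qed
  qed
  then show ?thesis
    unfolding simple_abstract_group_def
    by (intro conjI allI impI Z.factorgroup_is_group nontrivial)
qed

context octonion_algebra
begin

section \<open>Octonion identities\<close>

lemma N_scale: "N (k \<cdot> x) = k\<^sup>2 * N x"
  using quadratic_form_N by (simp add: quadratic_form_def)

lemma N_zero [simp]: "N 0 = 0"
  using N_scale[of 0 0] by simp

lemma N_uminus [simp]: "N (- x) = N x"
  using N_scale[of "-1" x] by simp

lemma N_add: "N (x + y) = N x + N y + polar N x y"
  by (simp add: polar_def)

lemma polar_zero [simp]: "polar N 0 x = 0" "polar N x 0 = 0"
  by (simp_all add: polar_def)

lemma polar_uminus: "polar N (- x) y = - polar N x y" "polar N y (- x) = - polar N y x"
  using polar_diff_left[of 0 x y] polar_diff_right[of y 0 x] by simp_all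

lemma N_diff: "N (x - y) = N x + N y - polar N x y"
  using N_add[of x "- y"] by (simp add: polar_uminus)

lemma polar_self: "polar N x x = 2 * N x"
  using N_scale[of 2 x] by (simp add: polar_def scale_left_distrib[of 1 1, simplified])

lemma omul_zero [simp]: "0 \<star> x = 0" "x \<star> 0 = 0"
  using omul_diff_left[of 0 0 x] omul_diff_right[of x 0 0] by simp_all

lemma omul_uminus: "(- x) \<star> y = - (x \<star> y)" "x \<star> (- y) = - (x \<star> y)"
  using omul_diff_left[of 0 x y] omul_diff_right[of x 0 y] by simp_all

lemma exists_polar_eq_1:
  assumes "x \<noteq> 0"
  shows "\<exists>y. polar N x y = 1"
proof -
  obtain y where y: "polar N x y \<noteq> 0" using assms polar_nondegenerate by blast
  have "polar N x (inverse (polar N x y) \<cdot> y) = 1" using y by (simp add: polar_scale_right)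
  then show ?thesis by blast
qed

lemma exists_nonzero: "\<exists>x::'o. x \<noteq> 0"
proof (rule ccontr)
  assume "\<not> ?thesis"
  then have "(UNIV :: 'o set) \<subseteq> span {}" by auto
  then have "dim (UNIV :: 'o set) \<le> card ({} :: 'o set)" by (intro dim_le_card) auto
  then show False using dim_eq_8 by simp
qed

lemma unit_nonzero: "unit \<noteq> 0"
proof
  assume "unit = 0"
  then have "x = 0" for x :: 'o using unit_left[of x] by simp
  then show False using exists_nonzero by blast
qed

lemma N_unit [simp]: "N unit = 1"
proof -
  have "N unit \<noteq> 0"
  proof
    assume 0: "N unit = 0"
    have "N x = 0" for x using N_omul[of unit x] 0 by (simp add: unit_left)
    then have "polar N x y = 0" for x y by (simp add: polar_def)
    then show False using exists_nonzero polar_nondegenerate by blast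
  qed
  moreover have "N unit * N unit = N unit" using N_omul[of unit unit] by (simp add: unit_left)
  ultimately show ?thesis by simp
qed

lemma T_unit [simp]: "T unit = 2"
  by (simp add: T_def polar_self)

lemma T_add: "T (x + y) = T x + T y"
  and T_diff: "T (x - y) = T x - T y"
  and T_scale: "T (k \<cdot> x) = k * T x"
  and T_uminus: "T (- x) = - T x"
  and T_zero [simp]: "T 0 = 0"
  by (simp_all add: T_def polar_add_left polar_diff_left polar_scale_left polar_uminus)

lemma polar_unit: "polar N x unit = T x" "polar N unit x = T x"
  by (simp_all add: T_def polar_commute)

lemma oconj_add: "oconj (x + y) = oconj x + oconj y"
  and oconj_diff: "oconj (x - y) = oconj x - oconj y"
  and oconj_scale: "oconj (k \<cdot> x) = k \<cdot> oconj x"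
  and oconj_uminus: "oconj (- x) = - oconj x"
  and oconj_zero [simp]: "oconj 0 = 0"
  by (simp_all add: oconj_def T_add T_diff T_scale T_uminus scale_left_distrib
      scale_right_diff_distrib scale_left_diff_distrib)

lemma oconj_unit [simp]: "oconj unit = unit"
proof -
  have "2 \<cdot> unit = unit + unit" using scale_left_distrib[of 1 1 unit] by simp
  then show ?thesis by (simp add: oconj_def)
qed

lemma T_oconj [simp]: "T (oconj x) = T x"
  by (simp add: oconj_def T_diff T_scale)

lemma oconj_oconj [simp]: "oconj (oconj x) = x"
  using T_oconj[of x] unfolding oconj_def[of "oconj x"] by (simp add: oconj_def)

lemma N_oconj [simp]: "N (oconj x) = N x"
  by (simp add: oconj_def N_diff N_scale polar_scale_left polar_unit power2_eq_square)

lemma polar_oconj [simp]: "polar N (oconj x) (oconj y) = polar N x y"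
  by (simp add: polar_def oconj_add[symmetric])

lemma polar_oconj_swap: "polar N (oconj x) y = polar N x (oconj y)"
  using polar_oconj[of x "oconj y"] by simp

lemma T_omul: "T (x \<star> y) = polar N x (oconj y)"
  by (simp add: T_def polar_omul_adjoint_right unit_left)

lemma T_omul': "T (x \<star> y) = polar N (oconj x) y"
  by (simp add: T_omul polar_oconj_swap)

lemma T_omul_commute: "T (x \<star> y) = T (y \<star> x)"
  by (simp add: T_omul polar_oconj_swap polar_commute[of y])

lemma oconj_omul: "oconj (x \<star> y) = oconj y \<star> oconj x"
proof (rule polar_eqI)
  fix z
  have "polar N (oconj (x \<star> y)) z = T ((x \<star> y) \<star> z)" by (simp add: T_omul')
  also have "\<dots> = T (x \<star> (y \<star> z))" by (rule T_assoc)
  also have "\<dots> = polar N (oconj x) (y \<star> z)" by (simp add: T_omul')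
  also have "\<dots> = polar N (oconj y \<star> oconj x) z"
    by (simp add: polar_omul_adjoint_left)
  finally show "polar N (oconj (x \<star> y)) z = polar N (oconj y \<star> oconj x) z" .
qed

lemma oconj_omul_cancel_left: "oconj x \<star> (x \<star> y) = N x \<cdot> y"
proof (rule polar_eqI)
  fix z
  show "polar N (oconj x \<star> (x \<star> y)) z = polar N (N x \<cdot> y) z"
    by (simp add: polar_omul_adjoint_left[of "oconj x"] polar_omul_left_same polar_scale_left)
qed

lemma omul_oconj_cancel_left: "x \<star> (oconj x \<star> y) = N x \<cdot> y"
  using oconj_omul_cancel_left[of "oconj x" y] by simp

lemma omul_oconj_cancel_right: "(y \<star> x) \<star> oconj x = N x \<cdot> y"
proof (rule polar_eqI)
  fix z
  show "polar N ((y \<star> x) \<star> oconj x) z = polar N (N x \<cdot> y) z"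
    by (simp add: polar_omul_adjoint_right[of "y \<star> x"] polar_omul_right_same polar_scale_left)
qed

lemma oconj_omul_cancel_right: "(y \<star> oconj x) \<star> x = N x \<cdot> y"
  using omul_oconj_cancel_right[of y "oconj x"] by simp

lemma omul_left_cancel:
  assumes "N x \<noteq> 0" "x \<star> y = x \<star> z"
  shows "y = z"
  by (metis assms oconj_omul_cancel_left scale_cancel_left)

lemma omul_right_cancel:
  assumes "N x \<noteq> 0" "y \<star> x = z \<star> x"
  shows "y = z"
  by (metis assms omul_oconj_cancel_right scale_cancel_left)

section \<open>Orthogonal complements of finite sets\<close>

definition perp :: "'o set \<Rightarrow> 'o set" where
  "perp U = {s. \<forall>u\<in>U. polar N s u = 0}"

lemma perp_insert_iff: "s \<in> perp (insert u U) \<longleftrightarrow> polar N s u = 0 \<and> s \<in> perp U"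
  by (simp add: perp_def)

lemma perp_add: "s \<in> perp U \<Longrightarrow> t \<in> perp U \<Longrightarrow> s + t \<in> perp U"
  and perp_diff: "s \<in> perp U \<Longrightarrow> t \<in> perp U \<Longrightarrow> s - t \<in> perp U"
  and perp_scale: "s \<in> perp U \<Longrightarrow> k \<cdot> s \<in> perp U"
  by (simp_all add: perp_def polar_add_left polar_diff_left polar_scale_left)

text \<open>These two facts do the duty of the dimension formula for orthogonal complements. In the inductive
  step a new vector \<open>u\<close> either cuts down nothing, or pairs nontrivially with some \<open>d\<close> in the old
  complement, and then \<open>d\<close> spans what is lost.\<close>

lemma perp_complement_and_double_perp:
  assumes "finite U"
  shows "(\<exists>D. finite D \<and> card D \<le> card U \<and> (\<forall>z. \<exists>h\<in>span D. z - h \<in> perp U)) \<and>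
    (\<forall>w. (\<forall>s\<in>perp U. polar N w s = 0) \<longrightarrow> w \<in> span U)"
  using assms
proof (induction U rule: finite_induct)
  case empty
  have "w \<in> span {}" if "\<forall>s\<in>perp {}. polar N w s = 0" for w
  proof -
    have "w = 0" by (rule polar_nondegenerate) (use that in \<open>simp add: perp_def\<close>)
    then show ?thesis by simp
  qed
  moreover have "\<exists>D. finite D \<and> card D \<le> card {} \<and> (\<forall>z. \<exists>h\<in>span D. z - h \<in> perp {})"
    by (rule exI[of _ "{}"]) (simp add: perp_def)
  ultimately show ?case by blast
next
  case (insert u U)
  then obtain D where D: "finite D" "card D \<le> card U" "\<And>z. \<exists>h\<in>span D. z - h \<in> perp U"
    by blast
  have W: "w \<in> span U" if "\<And>s. s \<in> perp U \<Longrightarrow> polar N w s = 0" for w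
    using insert.IH that by blast
  show ?case
  proof (cases "\<forall>s\<in>perp U. polar N s u = 0")
    case True
    then have "perp (insert u U) = perp U" by (auto simp: perp_insert_iff)
    moreover have "card D \<le> card (insert u U)" using insert.hyps D(2) by simp
    moreover have "span U \<subseteq> span (insert u U)" by (rule span_mono) blast
    ultimately show ?thesis using D(1,3) W by (metis subsetD)
  next
    case False
    then obtain d where d: "d \<in> perp U" "polar N d u \<noteq> 0" by blast
    have proj: "s - (polar N s u / polar N d u) \<cdot> d \<in> perp (insert u U)" if "s \<in> perp U" for s
      using that d
      by (simp add: perp_insert_iff perp_diff perp_scale polar_diff_left polar_scale_left)
    have "\<exists>h\<in>span (insert d D). z - h \<in> perp (insert u U)" for z
    proof -
      obtain h where h: "h \<in> span D" "z - h \<in> perp U" using D by blast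
      let ?k = "polar N (z - h) u / polar N d u"
      have "h \<in> span (insert d D)" using h(1) span_mono[of D "insert d D"] by auto
      then have "h + ?k \<cdot> d \<in> span (insert d D)"
        by (intro span_add span_scale) (auto intro: span_base)
      moreover have "z - (h + ?k \<cdot> d) \<in> perp (insert u U)"
        using proj[OF h(2)] by (simp add: algebra_simps)
      ultimately show ?thesis by blast
    qed
    moreover have "card (insert d D) \<le> card (insert u U)"
      using D insert.hyps by (simp add: card_insert_if)
    moreover have "w \<in> span (insert u U)" if w: "\<forall>s\<in>perp (insert u U). polar N w s = 0" for w
    proof -
      let ?k = "polar N w d / polar N d u"
      have "polar N (w - ?k \<cdot> u) s = 0" if "s \<in> perp U" for s
      proof -
        have "polar N w (s - (polar N s u / polar N d u) \<cdot> d) = 0" using w proj[OF that] by blast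
        then show ?thesis
          using d by (simp add: polar_diff_left polar_diff_right polar_scale_left polar_scale_right
              polar_commute[of u s])
      qed
      then have "w - ?k \<cdot> u \<in> span U" by (rule W)
      then show ?thesis by (auto simp: span_insert)
    qed
    ultimately show ?thesis using D(1) by (metis finite_insert)
  qed
qed

lemma perp_not_in_small_span:
  assumes U: "finite U" and V: "finite V" and small: "card U + card V < 8"
    and sub: "perp U \<subseteq> span V"
  shows False
proof -
  obtain D where D: "finite D" "card D \<le> card U" "\<And>z. \<exists>h\<in>span D. z - h \<in> perp U"
    using perp_complement_and_double_perp[OF U] by blast
  have "z \<in> span (D \<union> V)" for z
  proof -
    obtain h where h: "h \<in> span D" "z - h \<in> perp U" using D by blast
    then have "h \<in> span (D \<union> V)" "z - h \<in> span (D \<union> V)"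
      using sub span_mono[of D "D \<union> V"] span_mono[of V "D \<union> V"] by auto
    then have "h + (z - h) \<in> span (D \<union> V)" by (rule span_add)
    then show ?thesis by simp
  qed
  then have "dim UNIV \<le> card (D \<union> V)" by (intro dim_le_card) (use D V in auto)
  also have "\<dots> \<le> card D + card V" by (rule card_Un_le)
  finally show False using dim_eq_8 D small by simp
qed

text \<open>If \<open>N\<close> vanishes on the complement, so does the polar form; the complement then lies in its own
  complement, the span of \<open>U\<close>, and the whole space has dimension at most \<open>2 * card U\<close>. In dimension 8
  this is impossible for up to three vectors; the split octonions, with totally isotropic subspaces of
  dimension 4, show that three is sharp.\<close>

lemma exists_nonisotropic_perp:
  assumes U: "finite U" and small: "card U \<le> 3"
  shows "\<exists>v\<in>perp U. N v \<noteq> 0"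
proof (rule ccontr)
  assume "\<not> ?thesis"
  then have N0: "N v = 0" if "v \<in> perp U" for v using that by blast
  have "polar N w s = 0" if "w \<in> perp U" "s \<in> perp U" for w s
    using that by (simp add: polar_def N0 perp_add)
  then have "perp U \<subseteq> span U"
    using perp_complement_and_double_perp[OF U] by blast
  then show False using perp_not_in_small_span[OF U U] small by simp
qed

lemma exists_nonisotropic_perp3:
  "\<exists>v. N v \<noteq> 0 \<and> polar N v a = 0 \<and> polar N v b = 0 \<and> polar N v c = 0"
proof -
  have "card {a, b, c} \<le> 3" by (simp add: card_insert_if)
  then show ?thesis using exists_nonisotropic_perp[of "{a, b, c}"] by (auto simp: perp_def)
qed

section \<open>The nucleus of an octonion algebra\<close>

text \<open>Moving \<open>k\<close> past \<open>w\<close> conjugates it, up to an element of the plane spanned by \<open>unit\<close> and \<open>k\<close> that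
  vanishes when \<open>w\<close> is orthogonal to this plane.\<close>

lemma omul_swap: "k \<star> w = w \<star> oconj k + (T w \<cdot> k - polar N k w \<cdot> unit)"
proof -
  have "oconj (w \<star> oconj k) = T (w \<star> oconj k) \<cdot> unit - w \<star> oconj k" by (rule oconj_def)
  then have "w \<star> oconj k + k \<star> oconj w = polar N k w \<cdot> unit"
    by (simp add: oconj_omul T_omul polar_commute[of w k])
  then show ?thesis
    by (simp add: oconj_def[of w] omul_diff_right omul_scale_right unit_right algebra_simps)
qed

lemma omul_swap_perp:
  assumes "w \<in> perp {unit, k}"
  shows "k \<star> w = w \<star> oconj k"
  using omul_swap[of k w] assms by (simp add: perp_def polar_unit polar_commute[of w k])

text \<open>A nonisotropic \<open>w\<close> orthogonal to \<open>unit\<close> and \<open>k\<close> conjugates \<open>k\<close> and commutes with it, so \<open>k\<close> is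
  its own conjugate. In characteristic 2 this does not yet make \<open>k\<close> scalar; commuting with an element
  of trace 1 does.\<close>

lemma commuting_imp_scalar:
  assumes comm: "\<And>x. k \<star> x = x \<star> k"
  shows "\<exists>t. k = t \<cdot> unit"
proof -
  obtain w where w: "w \<in> perp {unit, k}" "N w \<noteq> 0"
    using exists_nonisotropic_perp3[of unit k 0] by (auto simp: perp_def)
  have "w \<star> k = w \<star> oconj k" using comm[of w] omul_swap_perp[OF w(1)] by simp
  then have k: "oconj k = k" using omul_left_cancel w(2) by metis
  obtain x where x: "T x = 1"
    using exists_polar_eq_1[OF unit_nonzero] by (auto simp: polar_unit)
  have "k \<star> x = x \<star> k + (T x \<cdot> k - polar N k x \<cdot> unit)" using omul_swap[of k x] k by simp
  then have "k = polar N k x \<cdot> unit" using comm[of x] x by simp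
  then show ?thesis by blast
qed

lemma omul_self: "x \<star> x = T x \<cdot> x - N x \<cdot> unit"
  using omul_conj[of x] by (simp add: oconj_def omul_diff_right omul_scale_right unit_right algebra_simps)

lemma left_alternative: "(x \<star> x) \<star> y = x \<star> (x \<star> y)"
  using oconj_omul_cancel_left[of x y]
  by (simp add: oconj_def omul_self omul_diff_left omul_scale_left unit_left algebra_simps)

lemma right_alternative: "(y \<star> x) \<star> x = y \<star> (x \<star> x)"
  using omul_oconj_cancel_right[of y x]
  by (simp add: oconj_def omul_self omul_diff_right omul_scale_right unit_right algebra_simps)

lemma left_alternative_linearized:
  "(x \<star> z) \<star> y + (z \<star> x) \<star> y = x \<star> (z \<star> y) + z \<star> (x \<star> y)"
  using left_alternative[of "x + z" y]
  by (simp add: omul_add_left omul_add_right left_alternative algebra_simps)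

lemma right_alternative_linearized:
  "(y \<star> x) \<star> z + (y \<star> z) \<star> x = y \<star> (x \<star> z) + y \<star> (z \<star> x)"
  using right_alternative[of y "x + z"]
  by (simp add: omul_add_left omul_add_right right_alternative algebra_simps)

text \<open>Let \<open>d\<close> be the commutator of \<open>k\<close> with some \<open>x\<close>. For \<open>B\<close> orthogonal to \<open>unit\<close>, \<open>k\<close> and \<open>x\<close>,
  moving \<open>k\<close> past \<open>x \<star> B\<close> in two ways shows that \<open>d \<star> B\<close> is a scalar. If \<open>N d\<close> is nonzero, every such
  \<open>B\<close> is a multiple of \<open>oconj d\<close>, which contradicts the dimension; if \<open>N d\<close> is zero, then
  \<open>d \<star> B = 0\<close>, and a nonisotropic \<open>B\<close> gives \<open>d = 0\<close>. So \<open>k\<close> commutes with everything.\<close>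

lemma nucleus_imp_scalar:
  assumes nuc: "\<And>x y. (x \<star> k) \<star> y = x \<star> (k \<star> y)"
  shows "\<exists>t. k = t \<cdot> unit"
proof (rule commuting_imp_scalar)
  fix x
  have left: "(k \<star> x) \<star> y = k \<star> (x \<star> y)" for x y
    using left_alternative_linearized[of x k y] nuc by simp
  have right: "(x \<star> y) \<star> oconj k = x \<star> (y \<star> oconj k)" for x y
    using right_alternative_linearized[of x y k] nuc
    by (simp add: oconj_def omul_diff_right omul_scale_right unit_right)
  define d where "d = k \<star> x - x \<star> k"
  let ?U = "{unit, k, x}"
  have U: "finite ?U" "card ?U \<le> 3" by (simp_all add: card_insert_if)
  have dB: "d \<star> B = - polar N k (x \<star> B) \<cdot> unit" if "B \<in> perp ?U" for B
  proof -
    have B: "B \<in> perp {unit, k}" using that by (simp add: perp_def)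
    have "T B = 0" "polar N x B = 0"
      using that by (simp_all add: perp_def polar_unit polar_commute[of x B])
    then have "T (x \<star> B) = 0" by (simp add: T_omul oconj_def polar_uminus)
    then have "k \<star> (x \<star> B) = (x \<star> B) \<star> oconj k - polar N k (x \<star> B) \<cdot> unit"
      using omul_swap[of k "x \<star> B"] by simp
    also have "(x \<star> B) \<star> oconj k = (x \<star> k) \<star> B"
      using right[of x B] omul_swap_perp[OF B] nuc[of x B] by simp
    finally show ?thesis by (simp add: d_def omul_diff_left left)
  qed
  have dB': "N d \<cdot> B = - polar N k (x \<star> B) \<cdot> oconj d" if "B \<in> perp ?U" for B
    using oconj_omul_cancel_left[of d B] dB[OF that] by (simp add: omul_scale_right omul_uminus unit_right)
  have "d = 0"
  proof (cases "N d = 0")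
    case True
    show ?thesis
    proof (rule ccontr)
      assume "d \<noteq> 0"
      then have od: "oconj d \<noteq> 0" using oconj_oconj[of d] by force
      obtain B where B: "B \<in> perp ?U" "N B \<noteq> 0" using exists_nonisotropic_perp[OF U] by blast
      have "polar N k (x \<star> B) = 0" using dB'[OF B(1)] True od by simp
      then have "d \<star> B = 0 \<star> B" using dB[OF B(1)] by simp
      then show False using omul_right_cancel[OF B(2)] \<open>d \<noteq> 0\<close> by blast
    qed
  next
    case False
    have "B \<in> span {oconj d}" if "B \<in> perp ?U" for B
    proof -
      have "B = inverse (N d) \<cdot> (N d \<cdot> B)" using False by simp
      also have "\<dots> \<in> span {oconj d}"
        unfolding dB'[OF that] by (intro span_scale span_base) simp
      finally show ?thesis .
    qed
    then have False using perp_not_in_small_span[of ?U "{oconj d}"] U by auto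
    then show ?thesis ..
  qed
  then show "k \<star> x = x \<star> k" by (simp add: d_def)
qed

lemma not_commutative: "\<exists>x y. x \<star> y \<noteq> y \<star> x"
proof (rule ccontr)
  assume "\<not> ?thesis"
  then have "x \<in> span {unit}" for x
    using commuting_imp_scalar[of x] span_scale[OF span_base[of unit "{unit}"]] by auto
  then show False using perp_not_in_small_span[of "{}" "{unit}"] by auto
qed

section \<open>Generation of the orthogonal group by reflections\<close>

definition reflection :: "'o \<Rightarrow> 'o \<Rightarrow> 'o" where
  "reflection v x = x - (polar N x v / N v) \<cdot> v"

definition orthogonal :: "('o \<Rightarrow> 'o) \<Rightarrow> bool" where
  "orthogonal \<alpha> \<longleftrightarrow> Vector_Spaces.linear scale scale \<alpha> \<and> (\<forall>x. N (\<alpha> x) = N x)"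

inductive reflection_product :: "('o \<Rightarrow> 'o) \<Rightarrow> bool" where
  id: "reflection_product id"
| step: "N v \<noteq> 0 \<Longrightarrow> reflection_product \<delta> \<Longrightarrow> reflection_product (reflection v \<circ> \<delta>)"

lemma reflection_product_comp:
  "reflection_product \<delta> \<Longrightarrow> reflection_product \<epsilon> \<Longrightarrow> reflection_product (\<delta> \<circ> \<epsilon>)"
  by (induction rule: reflection_product.induct)
    (auto simp: comp_assoc intro: reflection_product.step)

lemma reflection_product_reflection: "N v \<noteq> 0 \<Longrightarrow> reflection_product (reflection v)"
  using reflection_product.step[OF _ reflection_product.id] by simp

lemma orthogonal_reflection:
  assumes "N v \<noteq> 0"
  shows "orthogonal (reflection v)"
proof -
  have "Vector_Spaces.linear scale scale (reflection v)"
    by unfold_locales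
      (simp_all add: reflection_def polar_add_left polar_scale_left add_divide_distrib algebra_simps)
  moreover have "N (reflection v x) = N x" for x
    using assms by (simp add: reflection_def N_diff N_scale polar_scale_right power2_eq_square)
  ultimately show ?thesis by (simp add: orthogonal_def)
qed

lemma orthogonal_comp: "orthogonal \<alpha> \<Longrightarrow> orthogonal \<beta> \<Longrightarrow> orthogonal (\<alpha> \<circ> \<beta>)"
  using Vector_Spaces.linear_compose[of scale scale \<beta> scale \<alpha>] by (simp add: orthogonal_def)

lemma orthogonal_polar:
  assumes "orthogonal \<alpha>"
  shows "polar N (\<alpha> x) (\<alpha> y) = polar N x y"
proof -
  interpret a: Vector_Spaces.linear scale scale \<alpha> using assms by (simp add: orthogonal_def)
  show ?thesis using assms by (simp add: polar_def orthogonal_def a.add[symmetric])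
qed

lemma orthogonal_reflection_product: "reflection_product \<delta> \<Longrightarrow> orthogonal \<delta>"
proof (induction rule: reflection_product.induct)
  case id
  show ?case using linear_id by (simp add: orthogonal_def id_def)
next
  case (step v \<delta>)
  then show ?case by (intro orthogonal_comp orthogonal_reflection)
qed

text \<open>The Siegel transformation (also called Eichler transformation) of an isotropic \<open>w\<close> and a vector
  \<open>v\<close> orthogonal to it.\<close>

definition siegel :: "'o \<Rightarrow> 'o \<Rightarrow> 'o \<Rightarrow> 'o" where
  "siegel w v z = z + polar N z w \<cdot> v - polar N z v \<cdot> w - (N v * polar N z w) \<cdot> w"

lemma siegel_nonisotropic:
  assumes "N w = 0" "polar N v w = 0" "N v \<noteq> 0"
  shows "reflection_product (siegel w v)"
proof -
  let ?u = "v - N v \<cdot> w"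
  have Nu: "N ?u = N v"
    using assms by (simp add: N_diff N_scale polar_scale_right)
  have "reflection ?u (reflection v z) = siegel w v z" for z
  proof -
    let ?p = "polar N z v" and ?q = "polar N z w"
    have "polar N (reflection v z) ?u = - ?p - N v * ?q"
      using assms by (simp add: reflection_def polar_diff_right polar_diff_left polar_scale_left
          polar_scale_right polar_self field_simps)
    then have "polar N (reflection v z) ?u / N ?u = - (?p / N v) - ?q"
      using assms Nu by (simp add: field_simps)
    then have "reflection ?u (reflection v z) = z - (?p / N v) \<cdot> v - (- (?p / N v) - ?q) \<cdot> ?u"
      by (simp add: reflection_def)
    also have "\<dots> = siegel w v z"
      using assms by (simp add: siegel_def scale_left_diff_distrib scale_right_diff_distrib
          algebra_simps)
    finally show ?thesis .
  qed
  then have "siegel w v = reflection ?u \<circ> reflection v" by auto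
  then show ?thesis
    using assms Nu by (simp add: reflection_product_reflection reflection_product_comp)
qed

lemma siegel_add:
  assumes "N w = 0" "polar N v w = 0" "polar N v' w = 0"
  shows "siegel w (v + v') = siegel w v \<circ> siegel w v'"
proof
  fix z
  show "siegel w (v + v') z = (siegel w v \<circ> siegel w v') z"
    using assms
    by (simp add: siegel_def N_add polar_add_right polar_add_left polar_diff_left polar_scale_left
        polar_scale_right polar_self polar_commute[of w v] polar_commute[of v' v] algebra_simps)
qed

text \<open>An isotropic \<open>v\<close> is the sum of two nonisotropic vectors orthogonal to \<open>w\<close>, and the Siegel
  transformation is additive in \<open>v\<close>.\<close>

lemma reflection_product_siegel:
  assumes "N w = 0" "N v = 0" "polar N v w = 0"
  shows "reflection_product (siegel w v)"
proof -
  obtain u where u: "u \<in> perp {w, v}" "N u \<noteq> 0"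
    using exists_nonisotropic_perp3[of w v 0] by (auto simp: perp_def)
  then have pu: "polar N u w = 0" "polar N u v = 0" "polar N v u = 0"
    by (simp_all add: perp_def polar_commute[of v u])
  then have "N (v - u) = N u" using assms by (simp add: N_diff)
  moreover have "siegel w v = siegel w u \<circ> siegel w (v - u)"
    using siegel_add[of w u "v - u"] assms pu by (simp add: polar_diff_left)
  ultimately show ?thesis
    using assms u pu
    by (simp add: reflection_product_comp siegel_nonisotropic polar_diff_left)
qed

text \<open>If some \<open>\<alpha> w - w\<close> is nonisotropic, the reflection in it maps \<open>\<alpha> w\<close> to \<open>w\<close> and keeps the fixed
  vectors of \<open>\<alpha>\<close>. Otherwise \<open>\<eta> x = \<alpha> x - x\<close> has totally isotropic values and \<open>polar N x (\<eta> y)\<close> is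
  alternating; a Siegel transformation built from \<open>\<eta> x\<close> and \<open>\<eta> y\<close>, with \<open>y\<close> dual to \<open>\<eta> x\<close>, keeps the
  fixed vectors of \<open>\<alpha>\<close> and maps \<open>\<alpha> x\<close> to \<open>x\<close>.\<close>

lemma orthogonal_step:
  assumes \<alpha>: "orthogonal \<alpha>" and nid: "\<alpha> \<noteq> id"
  shows "\<exists>\<delta>. reflection_product \<delta> \<and> {x. \<alpha> x = x} \<subset> {x. \<delta> (\<alpha> x) = x}"
proof (cases "\<exists>w. N (\<alpha> w - w) \<noteq> 0")
  case True
  then obtain w where w: "N (\<alpha> w - w) \<noteq> 0" by blast
  let ?v = "\<alpha> w - w"
  have Nw: "N (\<alpha> x) = N x" for x using \<alpha> by (simp add: orthogonal_def)
  have "reflection ?v (\<alpha> w) = w"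
  proof -
    have "polar N (\<alpha> w) ?v = N ?v"
      by (simp add: polar_diff_right polar_self N_diff Nw)
    then show ?thesis using w by (simp add: reflection_def)
  qed
  moreover have "reflection ?v (\<alpha> x) = x" if "\<alpha> x = x" for x
  proof -
    have "polar N (\<alpha> x) ?v = 0" using orthogonal_polar[OF \<alpha>, of x w] that
      by (simp add: polar_diff_right)
    then show ?thesis using that by (simp add: reflection_def)
  qed
  moreover have "\<alpha> w \<noteq> w" using w by auto
  ultimately have "{x. \<alpha> x = x} \<subset> {x. reflection ?v (\<alpha> x) = x}" by blast
  then show ?thesis using reflection_product_reflection[OF w] by blast
next
  case False
  interpret a: Vector_Spaces.linear scale scale \<alpha> using \<alpha> by (simp add: orthogonal_def)
  define \<eta> where "\<eta> = (\<lambda>x. \<alpha> x - x)"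
  have \<alpha>\<eta>: "\<alpha> x = x + \<eta> x" for x by (simp add: \<eta>_def)
  have \<eta>_add: "\<eta> (x + y) = \<eta> x + \<eta> y" for x y by (simp add: \<eta>_def a.add)
  have N\<eta>: "N (\<eta> x) = 0" for x using False by (simp add: \<eta>_def)
  have \<eta>\<eta>: "polar N (\<eta> x) (\<eta> y) = 0" for x y
    by (simp add: polar_def N\<eta> \<eta>_add[symmetric])
  have alt: "polar N x (\<eta> x) = 0" for x
  proof -
    have "N (x + \<eta> x) = N x" using \<alpha> by (simp add: orthogonal_def \<alpha>\<eta>[symmetric])
    then show ?thesis by (simp add: N_add N\<eta>)
  qed
  have skew: "polar N x (\<eta> y) = - polar N y (\<eta> x)" for x y
    using alt[of "x + y"] alt[of x] alt[of y]
    by (simp add: \<eta>_add polar_add_left polar_add_right eq_neg_iff_add_eq_0 add.commute)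
  obtain x where x: "\<eta> x \<noteq> 0" using nid by (auto simp: \<eta>_def fun_eq_iff)
  obtain y where y: "polar N (\<eta> x) y = 1" using exists_polar_eq_1[OF x] by blast
  let ?\<delta> = "siegel (\<eta> x) (- \<eta> y)"
  have "reflection_product ?\<delta>"
    by (rule reflection_product_siegel) (simp_all add: N\<eta> \<eta>\<eta> polar_uminus)
  moreover have "?\<delta> (\<alpha> x) = x"
  proof -
    have "polar N x (\<eta> y) = - 1" using skew[of x y] y by (simp add: polar_commute[of y])
    then show ?thesis
      by (simp add: siegel_def \<alpha>\<eta> N\<eta> polar_add_left polar_uminus \<eta>\<eta> alt)
  qed
  moreover have "?\<delta> (\<alpha> z) = z" if "\<alpha> z = z" for z
  proof -
    have "\<eta> z = 0" using that by (simp add: \<eta>_def)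
    then have "polar N z (\<eta> u) = 0" for u using skew[of z u] by simp
    then show ?thesis using that by (simp add: siegel_def N\<eta> polar_uminus)
  qed
  moreover have "\<alpha> x \<noteq> x" using x by (simp add: \<eta>_def)
  ultimately show ?thesis by blast
qed

text \<open>The Cartan-Dieudonne theorem for the norm form, in every characteristic.\<close>

theorem orthogonal_imp_reflection_product:
  assumes "orthogonal \<alpha>"
  shows "\<exists>\<delta>. reflection_product \<delta> \<and> \<delta> \<circ> \<alpha> = id"
proof -
  obtain B where B: "independent B" "span B = UNIV" "card B = 8"
    using basis_exists[of UNIV] dim_eq_8 by (metis span_UNIV span_eq top.extremum_uniqueI)
  have "finite B" using B(3) card.infinite by fastforce
  with B interpret F: finite_dimensional_vector_space scale B by unfold_locales auto
  have fix_subspace: "subspace {x. \<alpha> x = x}" if "orthogonal \<alpha>" for \<alpha>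
  proof -
    interpret a: Vector_Spaces.linear scale scale \<alpha> using that by (simp add: orthogonal_def)
    show ?thesis by (simp add: subspace_def a.add a.scale)
  qed
  show ?thesis using assms
  proof (induction "8 - dim {x. \<alpha> x = x}" arbitrary: \<alpha> rule: less_induct)
    case less
    show ?case
    proof (cases "\<alpha> = id")
      case True
      then show ?thesis using reflection_product.id by auto
    next
      case False
      then obtain \<delta> where \<delta>: "reflection_product \<delta>" "{x. \<alpha> x = x} \<subset> {x. \<delta> (\<alpha> x) = x}"
        using orthogonal_step[OF less.prems] by blast
      have o: "orthogonal (\<delta> \<circ> \<alpha>)"
        using less.prems \<delta>(1) orthogonal_comp orthogonal_reflection_product by blast
      have "dim {x. \<alpha> x = x} < dim {x. (\<delta> \<circ> \<alpha>) x = x}"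
      proof (rule F.dim_psubset)
        have "span {x. \<alpha> x = x} = {x. \<alpha> x = x}"
          by (rule iffD2[OF span_eq_iff fix_subspace[OF less.prems]])
        moreover have "span {x. (\<delta> \<circ> \<alpha>) x = x} = {x. (\<delta> \<circ> \<alpha>) x = x}"
          by (rule iffD2[OF span_eq_iff fix_subspace[OF o]])
        ultimately show "span {x. \<alpha> x = x} \<subset> span {x. (\<delta> \<circ> \<alpha>) x = x}"
          using \<delta>(2) by (simp only: comp_apply)
      qed
      moreover have "dim {x. (\<delta> \<circ> \<alpha>) x = x} \<le> 8"
        using F.dim_subset[OF subset_UNIV] dim_eq_8 by metis
      ultimately have "8 - dim {x. (\<delta> \<circ> \<alpha>) x = x} < 8 - dim {x. \<alpha> x = x}" by linarith
      from less.hyps[OF this o] obtain \<epsilon> where "reflection_product \<epsilon>" "\<epsilon> \<circ> (\<delta> \<circ> \<alpha>) = id"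
        by blast
      then show ?thesis
        using \<delta>(1) by (intro exI[of _ "\<epsilon> \<circ> \<delta>"]) (simp add: reflection_product_comp comp_assoc)
    qed
  qed
qed

section \<open>Isometries of the determinant and its polarization\<close>

abbreviation isometries :: "(('f, 'o) albert \<Rightarrow> ('f, 'o) albert) set" where
  "isometries \<equiv> carrier SE6"

lemma isometry_iff:
  "g \<in> isometries \<longleftrightarrow> Vector_Spaces.linear albert_scale albert_scale g
    \<and> (\<forall>v. albert_det (g v) = albert_det v)"
  by (simp add: SE6_def del: split_paired_All)

lemma isometryI:
  assumes "\<And>v w. g (v + w) = g v + g w" "\<And>k v. g (albert_scale k v) = albert_scale k (g v)"
    and "\<And>v. albert_det (g v) = albert_det v"
  shows "g \<in> isometries"
proof -
  interpret J: vector_space albert_scale by (rule vector_space_albert)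
  have "Vector_Spaces.linear albert_scale albert_scale g"
    by unfold_locales (rule assms)+
  then show ?thesis using assms(3) by (simp add: isometry_iff del: split_paired_All)
qed

lemma isometry_linear: "g \<in> isometries \<Longrightarrow> Vector_Spaces.linear albert_scale albert_scale g"
  by (simp add: isometry_iff)

lemma isometry_det: "g \<in> isometries \<Longrightarrow> albert_det (g v) = albert_det v"
  unfolding isometry_iff by blast

lemma isometry_add: "g \<in> isometries \<Longrightarrow> g (v + w) = g v + g w"
  and isometry_scale: "g \<in> isometries \<Longrightarrow> g (albert_scale k v) = albert_scale k (g v)"
proof -
  assume "g \<in> isometries"
  then interpret g: Vector_Spaces.linear albert_scale albert_scale g by (rule isometry_linear)
  show "g (v + w) = g v + g w" "g (albert_scale k v) = albert_scale k (g v)"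
    by (rule g.add g.scale)+
qed

lemma isometry_zero: "g \<in> isometries \<Longrightarrow> g 0 = 0"
  by (metis add_cancel_right_right isometry_add)

lemma isometry_diff: "g \<in> isometries \<Longrightarrow> g (v - w) = g v - g w"
  by (metis diff_add_cancel eq_diff_eq isometry_add)

lemma SE6_mult: "g \<otimes>\<^bsub>SE6\<^esub> h = g \<circ> h"
  by (simp add: SE6_def)

lemma SE6_one: "\<one>\<^bsub>SE6\<^esub> = id"
  by (simp add: SE6_def)

lemma isometry_comp: "g \<in> isometries \<Longrightarrow> h \<in> isometries \<Longrightarrow> g \<circ> h \<in> isometries"
  using monoid.m_closed[OF group.is_monoid[OF group_SE6], of g h] by (simp only: SE6_mult)

lemma isometry_id: "id \<in> isometries"
  using monoid.one_closed[OF group.is_monoid[OF group_SE6]] by (simp add: SE6_def)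

lemma isometry_inverse:
  assumes "g \<in> isometries"
  shows "\<exists>h\<in>isometries. g \<circ> h = id \<and> h \<circ> g = id"
  using group.l_inv[OF group_SE6 assms] group.r_inv[OF group_SE6 assms]
    group.inv_closed[OF group_SE6 assms] unfolding SE6_mult SE6_one by blast

text \<open>The full polarization of the determinant, a symmetric trilinear form in every characteristic.\<close>

definition tri :: "('f, 'o) albert \<Rightarrow> ('f, 'o) albert \<Rightarrow> ('f, 'o) albert \<Rightarrow> 'f" where
  "tri u v w = albert_det (u + v + w) - albert_det (u + v) - albert_det (v + w)
     - albert_det (u + w) + albert_det u + albert_det v + albert_det w"

lemma tri_isometry: "g \<in> isometries \<Longrightarrow> tri (g u) (g v) (g w) = tri u v w"
  by (simp add: tri_def isometry_add[symmetric] isometry_det)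

lemma tri_eq:
  "tri (a, b, c, A, B, C) (a', b', c', A', B', C') (a'', b'', c'', A'', B'', C'') =
     a * b' * c'' + a * b'' * c' + a' * b * c'' + a' * b'' * c + a'' * b * c' + a'' * b' * c
     - a * polar N A' A'' - a' * polar N A A'' - a'' * polar N A A'
     - b * polar N B' B'' - b' * polar N B B'' - b'' * polar N B B'
     - c * polar N C' C'' - c' * polar N C C'' - c'' * polar N C C'
     + T ((A \<star> B') \<star> C'') + T ((A \<star> B'') \<star> C') + T ((A' \<star> B) \<star> C'')
     + T ((A' \<star> B'') \<star> C) + T ((A'' \<star> B) \<star> C') + T ((A'' \<star> B') \<star> C)"
proof -
  \<comment> \<open>The polarization of a cubic map is additive in the map, so each monomial is polarized alone.\<close>
  define pol :: "(('f, 'o) albert \<Rightarrow> 'f) \<Rightarrow> ('f, 'o) albert \<Rightarrow> ('f, 'o) albert \<Rightarrow> ('f, 'o) albert \<Rightarrow> 'f"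
    where "pol f u v w = f (u + v + w) - f (u + v) - f (v + w) - f (u + w) + f u + f v + f w"
    for f u v w
  let ?f1 = "\<lambda>(a, b, c, A, B, C). a * b * c :: 'f"
  let ?f2 = "\<lambda>(a, b, c, A, B, C). a * N A"
  let ?f3 = "\<lambda>(a, b, c, A, B, C). b * N B"
  let ?f4 = "\<lambda>(a, b, c, A, B, C). c * N C"
  let ?f5 = "\<lambda>(a, b, c, A, B, C). T ((A \<star> B) \<star> C)"
  let ?u = "(a, b, c, A, B, C)" and ?v = "(a', b', c', A', B', C')" and ?w = "(a'', b'', c'', A'', B'', C'')"
  have split: "albert_det x = ?f1 x - ?f2 x - ?f3 x - ?f4 x + ?f5 x" for x
    by (cases x) (simp add: albert_det_def)
  have "tri u v w = pol ?f1 u v w - pol ?f2 u v w - pol ?f3 u v w - pol ?f4 u v w + pol ?f5 u v w"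
    for u v w
    unfolding tri_def pol_def split by (simp only: algebra_simps)
  moreover have "pol ?f1 ?u ?v ?w =
      a * b' * c'' + a * b'' * c' + a' * b * c'' + a' * b'' * c + a'' * b * c' + a'' * b' * c"
    by (simp add: pol_def algebra_simps)
  moreover have "pol ?f2 ?u ?v ?w = a * polar N A' A'' + a' * polar N A A'' + a'' * polar N A A'"
    "pol ?f3 ?u ?v ?w = b * polar N B' B'' + b' * polar N B B'' + b'' * polar N B B'"
    "pol ?f4 ?u ?v ?w = c * polar N C' C'' + c' * polar N C C'' + c'' * polar N C C'"
    by (simp_all add: pol_def N_add polar_add_left polar_add_right algebra_simps)
  moreover have "pol ?f5 ?u ?v ?w =
      T ((A \<star> B') \<star> C'') + T ((A \<star> B'') \<star> C') + T ((A' \<star> B) \<star> C'')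
      + T ((A' \<star> B'') \<star> C) + T ((A'' \<star> B) \<star> C') + T ((A'' \<star> B') \<star> C)"
    by (simp add: pol_def omul_add_left omul_add_right T_add algebra_simps)
  ultimately show ?thesis by (simp only: diff_diff_eq add.assoc)
qed

abbreviation e1 :: "('f, 'o) albert" where "e1 \<equiv> (1, 0, 0, 0, 0, 0)"
abbreviation e2 :: "('f, 'o) albert" where "e2 \<equiv> (0, 1, 0, 0, 0, 0)"
abbreviation e3 :: "('f, 'o) albert" where "e3 \<equiv> (0, 0, 1, 0, 0, 0)"

text \<open>Simultaneous permutations of rows and columns. They permute the six families of root elements
  below, so that most statements need a proof for one family only.\<close>

definition rot :: "('f, 'o) albert \<Rightarrow> ('f, 'o) albert" where
  "rot = (\<lambda>(a, b, c, A, B, C). (b, c, a, B, C, A))"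

definition flip :: "('f, 'o) albert \<Rightarrow> ('f, 'o) albert" where
  "flip = (\<lambda>(a, b, c, A, B, C). (b, a, c, oconj B, oconj A, oconj C))"

lemma rot_apply [simp]: "rot (a, b, c, A, B, C) = (b, c, a, B, C, A)"
  by (simp add: rot_def)

lemma flip_apply [simp]: "flip (a, b, c, A, B, C) = (b, a, c, oconj B, oconj A, oconj C)"
  by (simp add: flip_def)

lemma albert_scale_apply [simp]:
  "albert_scale k (a, b, c, A, B, C) = (k * a, k * b, k * c, k \<cdot> A, k \<cdot> B, k \<cdot> C)"
  by (simp add: albert_scale_def)

lemma albert_det_apply: "albert_det (a, b, c, A, B, C) =
     a * b * c - a * N A - b * N B - c * N C + T ((A \<star> B) \<star> C)"
  by (simp add: albert_det_def)

lemma rot_isometry: "rot \<in> isometries"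
proof (rule isometryI)
  fix v w :: "('f, 'o) albert" and k
  show "rot (v + w) = rot v + rot w" "rot (albert_scale k v) = albert_scale k (rot v)"
    by (cases v; cases w; simp)+
  have "T ((B \<star> C) \<star> A) = T ((A \<star> B) \<star> C)" for A B C
    using T_omul_commute[of "B \<star> C" A] T_assoc[of A B C] by simp
  then show "albert_det (rot v) = albert_det v"
    by (cases v) (simp add: albert_det_apply algebra_simps)
qed

lemma flip_isometry: "flip \<in> isometries"
proof (rule isometryI)
  fix v w :: "('f, 'o) albert" and k
  show "flip (v + w) = flip v + flip w" "flip (albert_scale k v) = albert_scale k (flip v)"
    by (cases v; cases w; simp add: oconj_add oconj_scale)+
  have "T ((oconj B \<star> oconj A) \<star> oconj C) = T ((A \<star> B) \<star> C)" for A B C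
  proof -
    have "(oconj B \<star> oconj A) \<star> oconj C = oconj (C \<star> (A \<star> B))" by (simp add: oconj_omul)
    then show ?thesis using T_omul_commute[of C "A \<star> B"] by simp
  qed
  then show "albert_det (flip v) = albert_det v"
    by (cases v) (simp add: albert_det_apply algebra_simps)
qed

lemma rot_rot_rot [simp]: "rot (rot (rot v)) = v"
  by (cases v) simp

lemma flip_flip [simp]: "flip (flip v) = v"
  by (cases v) simp

section \<open>Root elements\<close>

text \<open>The action by congruence of an elementary matrix, with \<open>x\<close> or its conjugate as the single
  off-diagonal entry: \<open>root12 x\<close> adds octonion multiples of the second row and column to the first,
  and the other families arise by permuting indices. The matrices do not form a group, as octonion
  multiplication is not associative, but each of these maps is linear and preserves the determinant.\<close>

definition root12 :: "'o \<Rightarrow> ('f, 'o) albert \<Rightarrow> ('f, 'o) albert" where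
  "root12 x = (\<lambda>(a, b, c, A, B, C).
     (a + b * N x + polar N x C, b, c, A, B + oconj A \<star> oconj x, C + b \<cdot> x))"

definition root21 :: "'o \<Rightarrow> ('f, 'o) albert \<Rightarrow> ('f, 'o) albert" where
  "root21 x = (\<lambda>(a, b, c, A, B, C).
     (a, b + a * N x + polar N x C, c, A + oconj x \<star> oconj B, B, C + a \<cdot> x))"

definition root23 :: "'o \<Rightarrow> ('f, 'o) albert \<Rightarrow> ('f, 'o) albert" where
  "root23 x = (\<lambda>(a, b, c, A, B, C).
     (a, b + c * N x + polar N x A, c, A + c \<cdot> x, B, C + oconj B \<star> oconj x))"

definition root32 :: "'o \<Rightarrow> ('f, 'o) albert \<Rightarrow> ('f, 'o) albert" where
  "root32 x = (\<lambda>(a, b, c, A, B, C).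
     (a, b, c + b * N x + polar N x A, A + b \<cdot> x, B + oconj x \<star> oconj C, C))"

definition root31 :: "'o \<Rightarrow> ('f, 'o) albert \<Rightarrow> ('f, 'o) albert" where
  "root31 x = (\<lambda>(a, b, c, A, B, C).
     (a, b, c + a * N x + polar N x B, A + oconj C \<star> oconj x, B + a \<cdot> x, C))"

definition root13 :: "'o \<Rightarrow> ('f, 'o) albert \<Rightarrow> ('f, 'o) albert" where
  "root13 x = (\<lambda>(a, b, c, A, B, C).
     (a + c * N x + polar N x B, b, c, A, B + c \<cdot> x, C + oconj x \<star> oconj A))"

lemma root_apply:
  "root12 x (a, b, c, A, B, C) =
     (a + b * N x + polar N x C, b, c, A, B + oconj A \<star> oconj x, C + b \<cdot> x)"
  "root21 x (a, b, c, A, B, C) =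
     (a, b + a * N x + polar N x C, c, A + oconj x \<star> oconj B, B, C + a \<cdot> x)"
  "root23 x (a, b, c, A, B, C) =
     (a, b + c * N x + polar N x A, c, A + c \<cdot> x, B, C + oconj B \<star> oconj x)"
  "root32 x (a, b, c, A, B, C) =
     (a, b, c + b * N x + polar N x A, A + b \<cdot> x, B + oconj x \<star> oconj C, C)"
  "root31 x (a, b, c, A, B, C) =
     (a, b, c + a * N x + polar N x B, A + oconj C \<star> oconj x, B + a \<cdot> x, C)"
  "root13 x (a, b, c, A, B, C) =
     (a + c * N x + polar N x B, b, c, A, B + c \<cdot> x, C + oconj x \<star> oconj A)"
  by (simp_all add: root12_def root21_def root23_def root32_def root31_def root13_def)

lemma root21_flip: "root21 x = flip \<circ> root12 (oconj x) \<circ> flip"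
  and root31_flip: "root31 x = flip \<circ> root32 (oconj x) \<circ> flip"
  by (rule ext, simp only: comp_apply split_paired_all flip_apply root_apply oconj_add oconj_scale
    oconj_omul oconj_oconj polar_oconj N_oconj prod.inject)+

lemma root_rot:
  "rot (root12 x v) = root31 x (rot v)" "rot (root23 x v) = root12 x (rot v)"
  "rot (root31 x v) = root23 x (rot v)" "rot (root21 x v) = root13 x (rot v)"
  "rot (root32 x v) = root21 x (rot v)" "rot (root13 x v) = root32 x (rot v)"
  by (cases v; simp add: root_apply)+

lemma root12_isometry: "root12 x \<in> isometries"
proof (rule isometryI)
  fix v w :: "('f, 'o) albert" and k
  show "root12 x (v + w) = root12 x v + root12 x w"
    by (cases v; cases w; simp add: root_apply polar_add_right omul_add_left oconj_add
        scale_left_distrib algebra_simps)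
  show "root12 x (albert_scale k v) = albert_scale k (root12 x v)"
    by (cases v; simp add: root_apply polar_scale_right omul_scale_left oconj_scale
        scale_right_distrib algebra_simps)
  obtain a b c A B C where v: "v = (a, b, c, A, B, C)" by (cases v)
  let ?X = "oconj A \<star> oconj x"
  have B: "polar N B ?X = T ((A \<star> B) \<star> x)" "N ?X = N A * N x"
    by (simp_all add: T_omul polar_omul_adjoint_left N_omul)
  have "(A \<star> ?X) = N A \<cdot> oconj x" by (rule omul_oconj_cancel_left)
  then have "T ((A \<star> (B + ?X)) \<star> (C + b \<cdot> x)) =
      T ((A \<star> B) \<star> C) + b * T ((A \<star> B) \<star> x) + N A * polar N x C + 2 * b * N A * N x"
    by (simp add: omul_add_left omul_add_right omul_scale_left omul_scale_right T_add T_scale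
        T_omul' polar_self algebra_simps)
  then show "albert_det (root12 x v) = albert_det v"
    by (simp add: v root_apply albert_det_apply B N_add N_scale polar_scale_right polar_commute[of C x]
        power2_eq_square algebra_simps)
qed

lemma root_isometry:
  "root12 x \<in> isometries" "root21 x \<in> isometries" "root23 x \<in> isometries"
  "root32 x \<in> isometries" "root31 x \<in> isometries" "root13 x \<in> isometries"
proof -
  have rotI: "h \<in> isometries" if "g \<in> isometries" "\<And>v. rot (h v) = g (rot v)" for g h
  proof -
    have "h v = rot (rot (g (rot v)))" for v by (metis that(2) rot_rot_rot)
    then have "h = rot \<circ> rot \<circ> g \<circ> rot" by auto
    then show ?thesis using that(1) rot_isometry by (simp add: isometry_comp)
  qed
  show 12: "root12 x \<in> isometries" for x by (rule root12_isometry)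
  show 21: "root21 x \<in> isometries" for x
    unfolding root21_flip by (intro isometry_comp flip_isometry 12)
  show "root23 x \<in> isometries" by (rule rotI[OF 12]) (rule root_rot)
  then show "root31 x \<in> isometries" by (rule rotI) (rule root_rot)
  show "root32 x \<in> isometries" by (rule rotI[OF 21]) (rule root_rot)
  then show "root13 x \<in> isometries" by (rule rotI) (rule root_rot)
qed

lemma root_add:
  "root12 x (root12 y v) = root12 (x + y) v" "root21 x (root21 y v) = root21 (x + y) v"
  "root23 x (root23 y v) = root23 (x + y) v" "root32 x (root32 y v) = root32 (x + y) v"
  "root31 x (root31 y v) = root31 (x + y) v" "root13 x (root13 y v) = root13 (x + y) v"
  by (cases v; simp add: root_apply N_add polar_add_left polar_add_right polar_scale_right oconj_add
      omul_add_left omul_add_right scale_right_distrib algebra_simps)+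

lemma root_zero [simp]:
  "root12 0 v = v" "root21 0 v = v" "root23 0 v = v"
  "root32 0 v = v" "root31 0 v = v" "root13 0 v = v"
  by (cases v; simp add: root_apply)+

section \<open>The elementary group\<close>

definition roots :: "(('f, 'o) albert \<Rightarrow> ('f, 'o) albert) set" where
  "roots = range root12 \<union> range root21 \<union> range root23 \<union> range root32 \<union> range root31 \<union> range root13"

inductive_set elementary :: "(('f, 'o) albert \<Rightarrow> ('f, 'o) albert) set" where
  elementary_id: "id \<in> elementary"
| elementary_step: "r \<in> roots \<Longrightarrow> e \<in> elementary \<Longrightarrow> r \<circ> e \<in> elementary"

lemma roots_cases:
  assumes "r \<in> roots"
  obtains x where "r = root12 x" | x where "r = root21 x" | x where "r = root23 x"
    | x where "r = root32 x" | x where "r = root31 x" | x where "r = root13 x"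
  using assms unfolding roots_def by blast

lemma roots_mem: "root12 x \<in> roots" "root21 x \<in> roots" "root23 x \<in> roots"
  "root32 x \<in> roots" "root31 x \<in> roots" "root13 x \<in> roots"
  unfolding roots_def by blast+

lemma elementary_comp: "e \<in> elementary \<Longrightarrow> f \<in> elementary \<Longrightarrow> e \<circ> f \<in> elementary"
proof (induction rule: elementary.induct)
  case elementary_id
  then show ?case by simp
next
  case (elementary_step r e)
  then show ?case unfolding comp_assoc by (simp only: elementary.elementary_step)
qed

lemma roots_elementary: "r \<in> roots \<Longrightarrow> r \<in> elementary"
  using elementary_step[OF _ elementary_id] by simp

lemmas root_elementary = roots_mem[THEN roots_elementary]

lemma elementary_isometry: "e \<in> elementary \<Longrightarrow> e \<in> isometries"
proof (induction rule: elementary.induct)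
  case elementary_id
  show ?case by (rule isometry_id)
next
  case (elementary_step r e)
  then show ?case by (metis isometry_comp roots_cases root_isometry)
qed

lemma roots_inverse:
  assumes "r \<in> roots"
  shows "\<exists>s\<in>roots. s \<circ> r = id \<and> r \<circ> s = id"
proof -
  have inv: "\<exists>s\<in>roots. s \<circ> f x = id \<and> f x \<circ> s = id"
    if "\<And>x. f x \<in> roots" "\<And>x y v. f x (f y v) = f (x + y) v" "\<And>v. f 0 v = v"
    for f :: "'o \<Rightarrow> ('f, 'o) albert \<Rightarrow> ('f, 'o) albert" and x
    by (rule bexI[of _ "f (- x)"]) (simp_all only: that fun_eq_iff comp_apply id_apply
        left_minus right_minus simp_thms)
  show ?thesis
    using assms by (rule roots_cases) (auto intro!: inv roots_mem root_add simp del: split_paired_All)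
qed

lemma elementary_inverse:
  "e \<in> elementary \<Longrightarrow> \<exists>f\<in>elementary. f \<circ> e = id \<and> e \<circ> f = id"
proof (induction rule: elementary.induct)
  case elementary_id
  show ?case by (rule bexI[OF _ elementary.elementary_id]) simp
next
  case (elementary_step r e)
  then obtain f where f: "f \<in> elementary" "f \<circ> e = id" "e \<circ> f = id" by blast
  obtain s where s: "s \<in> roots" "s \<circ> r = id" "r \<circ> s = id"
    using roots_inverse elementary_step by blast
  have "(f \<circ> s) \<circ> (r \<circ> e) = f \<circ> (s \<circ> r) \<circ> e" "(r \<circ> e) \<circ> (f \<circ> s) = r \<circ> (e \<circ> f) \<circ> s"
    by (simp_all only: comp_assoc)
  then have "(f \<circ> s) \<circ> (r \<circ> e) = id" "(r \<circ> e) \<circ> (f \<circ> s) = id"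
    by (simp_all only: f s comp_id)
  moreover have "f \<circ> s \<in> elementary" using f(1) s(1) elementary_comp roots_elementary by blast
  ultimately show ?case by blast
qed

lemma elementary_rot:
  "e \<in> elementary \<Longrightarrow> \<exists>f\<in>elementary. \<forall>v. rot (e v) = f (rot v)"
proof (induction rule: elementary.induct)
  case elementary_id
  show ?case by (rule bexI[OF _ elementary.elementary_id]) (simp del: split_paired_All)
next
  case (elementary_step r e)
  then obtain f where f: "f \<in> elementary" "\<And>v. rot (e v) = f (rot v)" by blast
  from elementary_step obtain s where s: "s \<in> roots" "\<And>v. rot (r v) = s (rot v)"
    by (metis roots_cases root_rot roots_mem)
  show ?case
    using f s by (intro bexI[of _ "s \<circ> f"] elementary.elementary_step)
      (simp_all del: split_paired_All)
qed

section \<open>White vectors\<close>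

definition rad :: "('f, 'o) albert \<Rightarrow> ('f, 'o) albert set" where
  "rad u = {v. \<forall>w. tri u v w = 0}"

text \<open>White vectors are the vectors of rank one, characterized by the trilinear form and hence
  invariant under isometries: for such \<open>u\<close> the forms \<open>tri v z\<close> with \<open>v\<close> and \<open>z\<close> in the radical of \<open>u\<close>
  span more than a line, whereas for diagonal vectors with two nonzero entries they are all
  proportional. The inequality says that a 2 by 2 minor does not vanish.\<close>

definition white :: "('f, 'o) albert \<Rightarrow> bool" where
  "white u \<longleftrightarrow> u \<noteq> 0 \<and> (\<exists>v\<in>rad u. \<exists>v'\<in>rad u. \<exists>z\<in>rad u. \<exists>z'\<in>rad u. \<exists>w w'.
     tri v z w * tri v' z' w' \<noteq> tri v z w' * tri v' z' w)"

lemma white_isometry: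
  assumes g: "g \<in> isometries" and u: "white u"
  shows "white (g u)"
proof -
  obtain h where h: "h \<in> isometries" "g \<circ> h = id" "h \<circ> g = id"
    using isometry_inverse[OF g] by blast
  have gh: "g (h v) = v" "h (g v) = v" for v using h(2,3) by (metis comp_apply id_apply)+
  have rad: "g v \<in> rad (g u)" if "v \<in> rad u" for v
  proof -
    have "tri (g u) (g v) w = 0" for w
      using that tri_isometry[OF g, of u v "h w"] by (simp add: rad_def gh del: split_paired_All)
    then show ?thesis unfolding rad_def by blast
  qed
  obtain v v' z z' w w' where vw: "v \<in> rad u" "v' \<in> rad u" "z \<in> rad u" "z' \<in> rad u"
    "tri v z w * tri v' z' w' \<noteq> tri v z w' * tri v' z' w"
    using u unfolding white_def by blast
  have "tri (g v) (g z) (g w) * tri (g v') (g z') (g w')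
      \<noteq> tri (g v) (g z) (g w') * tri (g v') (g z') (g w)"
    using vw(5) by (simp only: tri_isometry[OF g] not_False_eq_True)
  moreover have "g u \<noteq> 0" using u gh(2)[of u] isometry_zero[OF h(1)] by (metis white_def)
  ultimately show ?thesis unfolding white_def using rad vw(1-4) by blast
qed

text \<open>With \<open>Y\<close> and \<open>Z\<close> in the second and third octonion entry, \<open>tri\<close> of these two radical vectors is
  the linear form given by \<open>T (X \<star> Y \<star> Z)\<close>; taking \<open>Y = unit\<close> and \<open>Z\<close> either \<open>unit\<close> or a nonscalar
  gives two independent forms.\<close>

lemma white_e1: "white e1"
proof -
  obtain k where k: "\<nexists>t. k = t \<cdot> unit"
    using not_commutative by (metis omul_scale_left omul_scale_right unit_left unit_right)
  have rad: "(0, 0, 0, 0, Y, Z) \<in> rad e1" for Y Z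
    unfolding rad_def by (auto simp: tri_eq)
  have "\<exists>X X'. T X * T (X' \<star> k) \<noteq> T X' * T (X \<star> k)"
  proof (rule ccontr)
    assume eq: "\<not> ?thesis"
    obtain X' where X': "T X' = 1" using exists_polar_eq_1[OF unit_nonzero] by (auto simp: polar_unit)
    have "oconj k = T (X' \<star> k) \<cdot> unit"
    proof (rule polar_eqI)
      fix X
      have "T X * T (X' \<star> k) = T (X \<star> k)" using eq X' by (metis mult_1)
      then show "polar N (oconj k) X = polar N (T (X' \<star> k) \<cdot> unit) X"
        by (simp add: T_omul[of X k] polar_commute[of X] polar_scale_left polar_unit mult.commute)
    qed
    then have "k = T (X' \<star> k) \<cdot> unit" by (metis oconj_oconj oconj_scale oconj_unit)
    then show False using k by blast
  qed
  then obtain X X' where XX: "T X * T (X' \<star> k) \<noteq> T X' * T (X \<star> k)" by blast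
  let ?v = "(0, 0, 0, 0, unit, 0)" and ?z = "(0, 0, 0, 0, 0, unit)" and ?z' = "(0, 0, 0, 0, 0, k)"
  have "tri ?v ?z (0, 0, 0, X, 0, 0) * tri ?v ?z' (0, 0, 0, X', 0, 0)
      \<noteq> tri ?v ?z (0, 0, 0, X', 0, 0) * tri ?v ?z' (0, 0, 0, X, 0, 0)"
    using XX by (simp add: tri_eq unit_right)
  moreover have "e1 \<noteq> 0" by (simp add: zero_prod_def)
  ultimately show ?thesis unfolding white_def using rad by blast
qed

lemma rad_diagonal:
  assumes "a \<noteq> 0" "b \<noteq> 0" "(p, q, r, X, Y, Z) \<in> rad (a, b, c, 0, 0, 0)"
  shows "X = 0" "Y = 0" "c \<cdot> Z = 0" "b * r + c * q = 0" "a * r + c * p = 0" "a * q + b * p = 0"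
proof -
  have D: "tri (a, b, c, 0, 0, 0) (p, q, r, X, Y, Z) w = 0" for w using assms(3) unfolding rad_def by blast
  show "X = 0" by (rule polar_nondegenerate) (use D[of "(0, 0, 0, _, 0, 0)"] assms in \<open>simp add: tri_eq\<close>)
  show "Y = 0" by (rule polar_nondegenerate) (use D[of "(0, 0, 0, 0, _, 0)"] assms in \<open>simp add: tri_eq\<close>)
  show "c \<cdot> Z = 0"
    by (rule polar_nondegenerate) (use D[of "(0, 0, 0, 0, 0, _)"] assms in \<open>simp add: tri_eq polar_scale_left\<close>)
  show "b * r + c * q = 0" "a * r + c * p = 0" "a * q + b * p = 0"
    using D[of e1] D[of e2] D[of e3] by (simp_all add: tri_eq algebra_simps)
qed

text \<open>If \<open>c\<close> is nonzero, the radical is at most a line. If \<open>c = 0\<close>, every product of two radical vectors is a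
  multiple of the third coordinate form.\<close>

lemma not_white_diagonal12:
  assumes ab: "a \<noteq> 0" "b \<noteq> 0"
  shows "\<not> white (a, b, c, 0, 0, 0)"
proof -
  have "tri v z w * tri v' z' w' = tri v z w' * tri v' z' w"
    if rads: "v \<in> rad (a, b, c, 0, 0, 0)" "v' \<in> rad (a, b, c, 0, 0, 0)"
       "z \<in> rad (a, b, c, 0, 0, 0)" "z' \<in> rad (a, b, c, 0, 0, 0)" for v v' z z' w w'
  proof (cases "c = 0")
    case True
    have *: "\<exists>p q Z. v = (p, q, 0, 0, 0, Z)" if "v \<in> rad (a, b, c, 0, 0, 0)" for v
      using that rad_diagonal[OF ab, where c = c] True ab by (cases v) auto
    have form: "\<exists>t. \<forall>w. tri v z w = t * fst (snd (snd w))"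
      if vz: "v \<in> rad (a, b, c, 0, 0, 0)" "z \<in> rad (a, b, c, 0, 0, 0)" for v z
    proof -
      obtain p q Z p' q' Z' where "v = (p, q, 0, 0, 0, Z)" "z = (p', q', 0, 0, 0, Z')"
        using *[OF vz(1)] *[OF vz(2)] by blast
      then have "tri v z w = (p * q' + p' * q - polar N Z Z') * fst (snd (snd w))" for w
        by (cases w) (simp add: tri_eq algebra_simps)
      then show ?thesis by blast
    qed
    obtain t t' where "\<forall>w. tri v z w = t * fst (snd (snd w))"
      "\<forall>w. tri v' z' w = t' * fst (snd (snd w))"
      using form[OF rads(1) rads(3)] form[OF rads(2) rads(4)] by blast
    then show ?thesis by (simp only: mult_ac)
  next
    case False
    define y where "y = (1 :: 'f, - (b / a), - (c / a), 0 :: 'o, 0 :: 'o, 0 :: 'o)"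
    have *: "\<exists>p. v = albert_scale p y" if v: "v \<in> rad (a, b, c, 0, 0, 0)" for v
    proof -
      obtain p q r X Y Z where pq: "v = (p, q, r, X, Y, Z)" by (cases v)
      from rad_diagonal[OF ab v[unfolded pq]] False ab have "v = albert_scale p y"
        by (simp add: pq y_def field_simps eq_neg_iff_add_eq_0)
      then show ?thesis by blast
    qed
    have lin: "tri (albert_scale p y) (albert_scale q y) w = p * q * tri y y w" for p q w
      by (cases w) (simp add: y_def tri_eq algebra_simps)
    obtain p p' q q' where "v = albert_scale p y" "v' = albert_scale p' y"
      "z = albert_scale q y" "z' = albert_scale q' y" using *[OF rads(1)] *[OF rads(2)] *[OF rads(3)] *[OF rads(4)] by blast
    then show ?thesis by (simp only: lin mult_ac)
  qed
  then show ?thesis unfolding white_def by blast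
qed

lemma not_white_diagonal:
  assumes "(a \<noteq> 0 \<and> b \<noteq> 0) \<or> (b \<noteq> 0 \<and> c \<noteq> 0) \<or> (c \<noteq> 0 \<and> a \<noteq> 0)"
  shows "\<not> white (a, b, c, 0, 0, 0)"
proof
  assume w: "white (a, b, c, 0, 0, 0)"
  then have w': "white (b, c, a, 0, 0, 0)" using white_isometry[OF rot_isometry] by fastforce
  then have "white (c, a, b, 0, 0, 0)" using white_isometry[OF rot_isometry] by fastforce
  then show False using w w' assms not_white_diagonal12 by blast
qed

text \<open>If the expression vanished identically, so would its polarization \<open>c * polar N x y\<close>, which forces
  \<open>c = 0\<close> and then \<open>A = 0\<close>.\<close>

lemma exists_quadratic_value:
  assumes "c \<noteq> 0 \<or> A \<noteq> 0"
  shows "\<exists>x. c * N x + polar N x A \<noteq> 0"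
proof (rule ccontr)
  assume *: "\<not> ?thesis"
  then have z: "c * N x + polar N x A = 0" for x by blast
  have "c * polar N x y = 0" for x y
  proof -
    have "c * N (x + y) + polar N (x + y) A - (c * N x + polar N x A) - (c * N y + polar N y A) = 0"
      unfolding z by simp
    then show ?thesis by (simp add: N_add polar_add_left algebra_simps)
  qed
  moreover obtain y where "polar N unit y = 1" using exists_polar_eq_1[OF unit_nonzero] by blast
  ultimately have c: "c = 0" by (metis mult_1_right)
  then have "A = 0" using z by (intro polar_nondegenerate) (simp add: polar_commute[of A])
  then show False using c assms by blast
qed

text \<open>Root elements that fix \<open>e1\<close> diagonalize the block with entries \<open>b\<close>, \<open>c\<close>, \<open>A\<close>; if the block were
  nonzero, this would lead to a white diagonal vector with two nonzero entries.\<close>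

lemma white_block:
  assumes w: "white (a, b, c, A, 0, 0)" and a: "a \<noteq> 0"
  shows "b = 0" "c = 0" "A = 0"
proof -
  have main: "b = 0" if "white (a, b, c, A, 0, 0)" for b c A
  proof (rule ccontr)
    assume b: "b \<noteq> 0"
    let ?x = "- (inverse b \<cdot> A)"
    obtain c' where "root32 ?x (a, b, c, A, 0, 0) = (a, b, c', 0, 0, 0)"
      using b by (simp add: root_apply)
    then show False
      using white_isometry[OF root_isometry(4)[of ?x] that] not_white_diagonal[of a b c'] a b by simp
  qed
  have "c = 0 \<and> A = 0"
  proof (rule ccontr)
    assume "\<not> ?thesis"
    then obtain x where x: "c * N x + polar N x A \<noteq> 0" using exists_quadratic_value by blast
    have "white (a, b + c * N x + polar N x A, c, A + c \<cdot> x, 0, 0)"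
      using white_isometry[OF root_isometry(3)[of x] w] by (simp add: root_apply)
    then show False using main[OF w] main x by fastforce
  qed
  then show "b = 0" "c = 0" "A = 0" using main[OF w] by blast+
qed

text \<open>Row reduction: the pivot \<open>a\<close> clears \<open>B\<close> and \<open>C\<close>, and whiteness takes care of the rest. The root
  elements are named explicitly because later arguments depend on which idempotents they fix.\<close>

lemma white_reduce1:
  assumes w: "white (a, b, c, A, B, C)" and a: "a \<noteq> 0"
  shows "root21 (- (inverse a \<cdot> C)) (root31 (- (inverse a \<cdot> B)) (a, b, c, A, B, C)) = (a, 0, 0, 0, 0, 0)"
    (is "?v = _")
proof -
  have "B + a \<cdot> - (inverse a \<cdot> B) = 0" "C + a \<cdot> - (inverse a \<cdot> C) = 0"
    using a by simp_all
  then have "\<exists>b' c' A'. ?v = (a, b', c', A', 0, 0)"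
    by (simp only: root_apply) (intro exI, rule refl)
  then obtain b' c' A' where eq: "?v = (a, b', c', A', 0, 0)" by (elim exE)
  have "white ?v" by (rule white_isometry[OF root_isometry(2) white_isometry[OF root_isometry(5) w]])
  then have w': "white (a, b', c', A', 0, 0)" unfolding eq .
  show ?thesis unfolding eq white_block[OF w' a] ..
qed

lemma white_reduce2:
  assumes w: "white (a, b, c, A, B, C)" and b: "b \<noteq> 0"
  shows "root32 (- (inverse b \<cdot> A)) (root12 (- (inverse b \<cdot> C)) (a, b, c, A, B, C)) = (0, b, 0, 0, 0, 0)"
    (is "?v = _")
proof -
  have "rot ?v = (b, 0, 0, 0, 0, 0)"
    using white_reduce1[of b c a B C A] white_isometry[OF rot_isometry w] b
    by (simp add: root_rot)
  then have "rot (rot (rot ?v)) = (0, b, 0, 0, 0, 0)" by simp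
  then show ?thesis by (simp only: rot_rot_rot)
qed

lemma white_reduce3:
  assumes w: "white (a, b, c, A, B, C)" and c: "c \<noteq> 0"
  shows "root13 (- (inverse c \<cdot> B)) (root23 (- (inverse c \<cdot> A)) (a, b, c, A, B, C)) = (0, 0, c, 0, 0, 0)"
    (is "?v = _")
proof -
  have "rot ?v = (0, c, 0, 0, 0, 0)"
    using white_reduce2[of b c a B C A] white_isometry[OF rot_isometry w] c
    by (simp add: root_rot)
  then have "rot (rot (rot ?v)) = (0, 0, c, 0, 0, 0)" by simp
  then show ?thesis by (simp only: rot_rot_rot)
qed

lemma root_fixes:
  "root12 x e1 = e1" "root13 x e1 = e1" "root23 x e1 = e1" "root32 x e1 = e1"
  "root13 x e2 = e2" "root23 x e2 = e2"
  by (simp_all add: root_apply)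

text \<open>The condition on \<open>b\<close>, \<open>c\<close>, \<open>A\<close> says that the vector is opposite to \<open>e1\<close>, in the sense that it is
  outside the radical of \<open>e1\<close>.\<close>

lemma white_reach2:
  assumes w: "white (a, b, c, A, B, C)" and bcA: "b \<noteq> 0 \<or> c \<noteq> 0 \<or> A \<noteq> 0"
  shows "\<exists>e\<in>elementary. \<exists>l. e e1 = e1 \<and> l \<noteq> 0 \<and> e (a, b, c, A, B, C) = (0, l, 0, 0, 0, 0)"
proof -
  have main: "\<exists>e\<in>elementary. \<exists>l. e e1 = e1 \<and> l \<noteq> 0 \<and> e (a, b, c, A, B, C) = (0, l, 0, 0, 0, 0)"
    if "white (a, b, c, A, B, C)" "b \<noteq> 0" for a b c A B C
  proof -
    let ?e = "root32 (- (inverse b \<cdot> A)) \<circ> root12 (- (inverse b \<cdot> C))"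
    have "?e (a, b, c, A, B, C) = (0, b, 0, 0, 0, 0)"
      unfolding comp_apply by (rule white_reduce2[OF that])
    moreover have "?e e1 = e1" by (simp only: comp_apply root_fixes)
    moreover have "?e \<in> elementary" by (intro elementary_comp root_elementary)
    ultimately show ?thesis using that(2) by (intro bexI[of _ ?e] exI[of _ b] conjI)
  qed
  show ?thesis
  proof (cases "b = 0")
    case False
    show ?thesis by (rule main[OF w False])
  next
    case True
    then obtain x where x: "c * N x + polar N x A \<noteq> 0"
      using exists_quadratic_value bcA by blast
    let ?b = "b + c * N x + polar N x A"
    note eq = root_apply(3)[of x a b c A B C]
    have w': "white (a, ?b, c, A + c \<cdot> x, B, C + oconj B \<star> oconj x)"
      using white_isometry[OF root_isometry(3)[of x] w] unfolding eq .
    have b': "?b \<noteq> 0" using x True by simp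
    obtain e l where e: "e \<in> elementary" "e e1 = e1" "l \<noteq> 0"
      "e (a, ?b, c, A + c \<cdot> x, B, C + oconj B \<star> oconj x) = (0, l, 0, 0, 0, 0)"
      using main[OF w' b'] by (elim bexE exE conjE)
    have "e \<circ> root23 x \<in> elementary" by (intro elementary_comp root_elementary e)
    moreover have "(e \<circ> root23 x) e1 = e1" by (simp only: comp_apply root_fixes e)
    moreover have "(e \<circ> root23 x) (a, b, c, A, B, C) = (0, l, 0, 0, 0, 0)"
      by (simp only: comp_apply eq e)
    ultimately show ?thesis using e(3) by (intro bexI[of _ "e \<circ> root23 x"] exI[of _ l] conjI)
  qed
qed

lemma white_reach1:
  assumes w: "white v"
  shows "\<exists>e\<in>elementary. \<exists>l. l \<noteq> 0 \<and> e v = (l, 0, 0, 0, 0, 0)"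
proof -
  let ?P = "\<lambda>v. \<exists>e\<in>elementary. \<exists>l. l \<noteq> 0 \<and> e v = (l, 0, 0, 0, 0, 0)"
  have step: "?P v" if "?P (r v)" "r \<in> roots" for r v
  proof -
    obtain e l where e: "e \<in> elementary" "l \<noteq> 0" "e (r v) = (l, 0, 0, 0, 0, 0)" using \<open>?P (r v)\<close> by blast
    have "e \<circ> r \<in> elementary" by (rule elementary_comp[OF e(1) roots_elementary[OF \<open>r \<in> roots\<close>]])
    moreover have "(e \<circ> r) v = (l, 0, 0, 0, 0, 0)" using e(3) by simp
    ultimately show ?thesis using e(2) by (intro bexI[of _ "e \<circ> r"] exI[of _ l] conjI)
  qed
  have a: "?P (a, b, c, A, B, C)" if "white (a, b, c, A, B, C)" "a \<noteq> 0" for a b c A B C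
  proof -
    let ?e = "root21 (- (inverse a \<cdot> C)) \<circ> root31 (- (inverse a \<cdot> B))"
    have "?e \<in> elementary" by (intro elementary_comp root_elementary)
    moreover have "?e (a, b, c, A, B, C) = (a, 0, 0, 0, 0, 0)"
      unfolding comp_apply by (rule white_reduce1[OF that])
    ultimately show ?thesis using that(2) by (intro bexI[of _ ?e] exI[of _ a] conjI)
  qed
  have b: "?P (a, b, c, A, B, C)" if w: "white (a, b, c, A, B, C)" "b \<noteq> 0 \<or> C \<noteq> 0" for a b c A B C
  proof (cases "a = 0")
    case True
    obtain x where x: "b * N x + polar N x C \<noteq> 0" using exists_quadratic_value[OF w(2)] by blast
    have w': "white (root12 x (a, b, c, A, B, C))" by (rule white_isometry[OF root_isometry(1) w(1)])
    have "?P (root12 x (a, b, c, A, B, C))"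
      unfolding root_apply by (rule a[OF w'[unfolded root_apply]]) (use x True in simp)
    then show ?thesis by (rule step) (rule roots_mem)
  next
    case False
    show ?thesis by (rule a[OF w(1) False])
  qed
  have c: "?P (a, b, c, A, B, C)" if w: "white (a, b, c, A, B, C)" "c \<noteq> 0 \<or> B \<noteq> 0" for a b c A B C
  proof (cases "a = 0")
    case True
    obtain x where x: "c * N x + polar N x B \<noteq> 0" using exists_quadratic_value[OF w(2)] by blast
    have w': "white (root13 x (a, b, c, A, B, C))" by (rule white_isometry[OF root_isometry(6) w(1)])
    have "?P (root13 x (a, b, c, A, B, C))"
      unfolding root_apply by (rule a[OF w'[unfolded root_apply]]) (use x True in simp)
    then show ?thesis by (rule step) (rule roots_mem)
  next
    case False
    show ?thesis by (rule a[OF w(1) False])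
  qed
  obtain a' b' c' A' B' C' where v: "v = (a', b', c', A', B', C')" by (cases v)
  have w': "white (a', b', c', A', B', C')" using w v by simp
  consider "a' \<noteq> 0" | "b' \<noteq> 0 \<or> C' \<noteq> 0" | "c' \<noteq> 0 \<or> B' \<noteq> 0" | "A' \<noteq> 0" "b' = 0" "c' = 0"
    using w unfolding v white_def by (auto simp: zero_prod_def)
  then show ?thesis
  proof cases
    case 4
    obtain x where x: "0 * N x + polar N x A' \<noteq> 0" using exists_quadratic_value 4(1) by blast
    have w'': "white (root23 x v)" by (rule white_isometry[OF root_isometry(3) w])
    have "?P (root23 x v)"
      unfolding v root_apply by (rule b[OF w''[unfolded v root_apply]]) (use x 4 in simp)
    then show ?thesis by (rule step) (rule roots_mem)
  next
    case 1
    show ?thesis unfolding v by (rule a[OF w' 1])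
  next
    case 2
    show ?thesis unfolding v by (rule b[OF w' 2])
  next
    case 3
    show ?thesis unfolding v by (rule c[OF w' 3])
  qed
qed

section \<open>Diagonal isometries\<close>

text \<open>The coordinate blocks are determined by the trilinear form and the three idempotents, so an
  isometry that preserves the lines of the idempotents preserves the blocks.\<close>

lemma diagonal_isometry:
  assumes g: "g \<in> isometries"
    and ge: "g e1 = (l1, 0, 0, 0, 0, 0)" "g e2 = (0, l2, 0, 0, 0, 0)" "g e3 = (0, 0, l3, 0, 0, 0)"
  obtains \<alpha> \<beta> \<gamma> where
    "\<And>a b c A B C. g (a, b, c, A, B, C) = (l1 * a, l2 * b, l3 * c, \<alpha> A, \<beta> B, \<gamma> C)"
    "l1 * l2 * l3 = 1"
    "\<And>A. l1 * N (\<alpha> A) = N A" "\<And>B. l2 * N (\<beta> B) = N B" "\<And>C. l3 * N (\<gamma> C) = N C"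
    "\<And>A B C. T ((\<alpha> A \<star> \<beta> B) \<star> \<gamma> C) = T ((A \<star> B) \<star> C)"
    "Vector_Spaces.linear scale scale \<alpha>" "Vector_Spaces.linear scale scale \<beta>"
    "Vector_Spaces.linear scale scale \<gamma>"
proof -
  obtain h where h: "h \<in> isometries" "g \<circ> h = id"
    using isometry_inverse[OF g] by blast
  have surj: "\<exists>w. g w = z" for z using h(2) by (metis comp_apply id_apply)
  note gt = tri_isometry[OF g]
  have l: "l1 * l2 * l3 = 1" using gt[of e1 e2 e3] by (simp add: ge tri_eq)
  then have l0: "l1 \<noteq> 0" "l2 \<noteq> 0" "l3 \<noteq> 0" by auto
  \<comment> \<open>The off-diagonal blocks are cut out by the trilinear form and the three idempotents.\<close>
  have block: "\<exists>X Y Z. g v = (0, 0, 0, X, Y, Z)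
      \<and> ((\<forall>w. tri e1 v w = 0) \<longrightarrow> X = 0) \<and> ((\<forall>w. tri e2 v w = 0) \<longrightarrow> Y = 0)
      \<and> ((\<forall>w. tri e3 v w = 0) \<longrightarrow> Z = 0)"
    if v: "tri e1 e2 v = 0" "tri e2 e3 v = 0" "tri e1 e3 v = 0" for v
  proof -
    obtain p q r X Y Z where gv: "g v = (p, q, r, X, Y, Z)" by (cases "g v")
    have pqr: "p = 0" "q = 0" "r = 0"
      using gt[of e1 e2 v] gt[of e2 e3 v] gt[of e1 e3 v] v l0 by (simp_all add: ge gv tri_eq)
    have "X = 0" if X: "\<forall>w. tri e1 v w = 0"
    proof (rule polar_nondegenerate)
      fix z
      obtain w where w: "g w = (0, 0, 0, z, 0, 0)" using surj by blast
      have "tri e1 v w = 0" using X by blast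
      then show "polar N X z = 0" using gt[of e1 v w] l0 by (simp add: ge gv w tri_eq)
    qed
    moreover have "Y = 0" if X: "\<forall>w. tri e2 v w = 0"
    proof (rule polar_nondegenerate)
      fix z
      obtain w where w: "g w = (0, 0, 0, 0, z, 0)" using surj by blast
      have "tri e2 v w = 0" using X by blast
      then show "polar N Y z = 0" using gt[of e2 v w] l0 by (simp add: ge gv w tri_eq)
    qed
    moreover have "Z = 0" if X: "\<forall>w. tri e3 v w = 0"
    proof (rule polar_nondegenerate)
      fix z
      obtain w where w: "g w = (0, 0, 0, 0, 0, z)" using surj by blast
      have "tri e3 v w = 0" using X by blast
      then show "polar N Z z = 0" using gt[of e3 v w] l0 by (simp add: ge gv w tri_eq)
    qed
    ultimately show ?thesis using gv pqr by blast
  qed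
  have "\<exists>X. g (0, 0, 0, A, 0, 0) = (0, 0, 0, X, 0, 0)" for A
    using block[of "(0, 0, 0, A, 0, 0)"] by (auto simp: tri_eq)
  then obtain \<alpha> where \<alpha>: "\<And>A. g (0, 0, 0, A, 0, 0) = (0, 0, 0, \<alpha> A, 0, 0)" by metis
  have "\<exists>X. g (0, 0, 0, 0, B, 0) = (0, 0, 0, 0, X, 0)" for B
    using block[of "(0, 0, 0, 0, B, 0)"] by (auto simp: tri_eq)
  then obtain \<beta> where \<beta>: "\<And>B. g (0, 0, 0, 0, B, 0) = (0, 0, 0, 0, \<beta> B, 0)" by metis
  have "\<exists>X. g (0, 0, 0, 0, 0, C) = (0, 0, 0, 0, 0, X)" for C
    using block[of "(0, 0, 0, 0, 0, C)"] by (auto simp: tri_eq)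
  then obtain \<gamma> where \<gamma>: "\<And>C. g (0, 0, 0, 0, 0, C) = (0, 0, 0, 0, 0, \<gamma> C)" by metis
  have form: "g (a, b, c, A, B, C) = (l1 * a, l2 * b, l3 * c, \<alpha> A, \<beta> B, \<gamma> C)" for a b c A B C
  proof -
    have "(a, b, c, A, B, C) = albert_scale a e1 + albert_scale b e2 + albert_scale c e3
        + (0, 0, 0, A, 0, 0) + (0, 0, 0, 0, B, 0) + (0, 0, 0, 0, 0, C)" by simp
    then have "g (a, b, c, A, B, C) = albert_scale a (g e1) + albert_scale b (g e2)
        + albert_scale c (g e3) + g (0, 0, 0, A, 0, 0) + g (0, 0, 0, 0, B, 0) + g (0, 0, 0, 0, 0, C)"
      by (simp only: isometry_add[OF g] isometry_scale[OF g])
    then show ?thesis by (simp add: ge \<alpha> \<beta> \<gamma> mult.commute)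
  qed
  have det: "albert_det (g v) = albert_det v" for v by (rule isometry_det[OF g])
  have "l1 * N (\<alpha> A) = N A" "l2 * N (\<beta> A) = N A" "l3 * N (\<gamma> A) = N A" for A
    using det[of "(1, 0, 0, A, 0, 0)"] det[of "(0, 1, 0, 0, A, 0)"] det[of "(0, 0, 1, 0, 0, A)"]
      \<alpha>[of 0] \<beta>[of 0] \<gamma>[of 0]
    by (simp_all add: form albert_det_apply isometry_zero[OF g, unfolded zero_prod_def])
  moreover have "T ((\<alpha> A \<star> \<beta> B) \<star> \<gamma> C) = T ((A \<star> B) \<star> C)" for A B C
    using det[of "(0, 0, 0, A, B, C)"] by (simp add: form albert_det_apply)
  moreover have add: "g (v + w) = g v + g w" for v w by (rule isometry_add[OF g])
  have scale: "g (albert_scale k v) = albert_scale k (g v)" for k v by (rule isometry_scale[OF g])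
  have "\<alpha> (X + Y) = \<alpha> X + \<alpha> Y" "\<beta> (X + Y) = \<beta> X + \<beta> Y" "\<gamma> (X + Y) = \<gamma> X + \<gamma> Y"
    "\<alpha> (k \<cdot> X) = k \<cdot> \<alpha> X" "\<beta> (k \<cdot> X) = k \<cdot> \<beta> X" "\<gamma> (k \<cdot> X) = k \<cdot> \<gamma> X" for X Y k
    using add[of "(0, 0, 0, X, X, X)" "(0, 0, 0, Y, Y, Y)"] scale[of k "(0, 0, 0, X, X, X)"]
    by (simp_all add: form)
  then have "Vector_Spaces.linear scale scale \<alpha>" "Vector_Spaces.linear scale scale \<beta>"
    "Vector_Spaces.linear scale scale \<gamma>" by (unfold_locales, blast+)+
  ultimately show thesis using that[OF form l] by blast
qed

section \<open>Lifting reflections to the Albert space\<close>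

lemma reflection_scale: "t \<noteq> 0 \<Longrightarrow> reflection (t \<cdot> v) = reflection v"
  by (simp add: fun_eq_iff reflection_def polar_scale_right N_scale power2_eq_square)

lemma reflection_reflection: "N v \<noteq> 0 \<Longrightarrow> reflection v (reflection v x) = x"
  by (simp add: reflection_def polar_diff_left polar_scale_left polar_self add_divide_distrib
      scale_left_distrib algebra_simps)

text \<open>The analogue of the Weyl element of the special linear group of degree 2: it exchanges the lines
  of \<open>e1\<close> and \<open>e2\<close> and acts on the entry \<open>C\<close> as the reflection in \<open>x\<close>.\<close>

definition lifted_reflection :: "'o \<Rightarrow> ('f, 'o) albert \<Rightarrow> ('f, 'o) albert" where
  "lifted_reflection x = root21 x \<circ> root12 (- (inverse (N x) \<cdot> x)) \<circ> root21 x"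

lemma lifted_reflection_elementary: "lifted_reflection x \<in> elementary"
  unfolding lifted_reflection_def by (intro elementary_comp root_elementary)

lemma lifted_reflection_apply:
  assumes n: "N x \<noteq> 0"
  shows "lifted_reflection x (a, b, c, A, B, C) =
    (inverse (N x) * b, N x * a, c, oconj x \<star> oconj B, - (inverse (N x) \<cdot> (oconj A \<star> oconj x)), reflection x C)"
proof -
  let ?n = "N x" and ?p = "polar N x C"
  let ?y = "- (inverse ?n \<cdot> x)"
  let ?b = "b + a * ?n + ?p" and ?A = "A + oconj x \<star> oconj B"
  let ?C = "reflection x C - (inverse ?n * b) \<cdot> x"
  have B: "B + oconj ?A \<star> oconj ?y = - (inverse ?n \<cdot> (oconj A \<star> oconj x))"
    using n by (simp add: oconj_add oconj_omul oconj_uminus oconj_scale omul_uminus omul_scale_right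
        omul_add_left omul_oconj_cancel_right scale_right_distrib)
  have "a + ?b * N ?y + polar N ?y (C + a \<cdot> x) = inverse ?n * b"
    using n by (simp add: N_scale polar_uminus polar_scale_left polar_add_right polar_scale_right
        polar_self power2_eq_square field_simps)
  moreover have "C + a \<cdot> x + ?b \<cdot> ?y = ?C"
  proof -
    have "?b \<cdot> ?y = - ((?b * inverse ?n) \<cdot> x)" by simp
    also have "?b * inverse ?n = inverse ?n * b + a + ?p / ?n" using n by (simp add: field_simps)
    finally show ?thesis
      by (simp add: reflection_def scale_left_distrib polar_commute[of C x] algebra_simps)
  qed
  ultimately have 2: "root12 ?y (root21 x (a, b, c, A, B, C)) =
      (inverse ?n * b, ?b, c, ?A, - (inverse ?n \<cdot> (oconj A \<star> oconj x)), ?C)"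
    unfolding root_apply B by simp
  have "polar N x ?C = - ?p - 2 * b"
    using n by (simp add: reflection_def polar_diff_right polar_scale_right polar_self
        polar_commute[of C x])
  then have "?b + inverse ?n * b * ?n + polar N x ?C = ?n * a" using n by (simp add: algebra_simps)
  moreover have "?A + oconj x \<star> oconj (- (inverse ?n \<cdot> (oconj A \<star> oconj x))) = oconj x \<star> oconj B"
    using n by (simp add: oconj_uminus oconj_scale oconj_omul omul_uminus omul_scale_right
        oconj_omul_cancel_left)
  ultimately show ?thesis
    unfolding lifted_reflection_def comp_apply 2 by (simp add: root_apply)
qed

text \<open>The two shapes record the parity of the number of reflections: an odd product exchanges the first
  two idempotents and the first two octonion entries.\<close>

definition even_shape :: "(('f, 'o) albert \<Rightarrow> ('f, 'o) albert) \<Rightarrow> ('o \<Rightarrow> 'o) \<Rightarrow> bool" where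
  "even_shape e \<gamma> \<longleftrightarrow> (\<exists>l m \<alpha> \<beta>. \<forall>a b c A B C.
     e (a, b, c, A, B, C) = (l * a, m * b, c, \<alpha> A, \<beta> B, \<gamma> C))"

definition odd_shape :: "(('f, 'o) albert \<Rightarrow> ('f, 'o) albert) \<Rightarrow> ('o \<Rightarrow> 'o) \<Rightarrow> bool" where
  "odd_shape e \<gamma> \<longleftrightarrow> (\<exists>l m \<alpha> \<beta>. \<forall>a b c A B C.
     e (a, b, c, A, B, C) = (l * b, m * a, c, \<alpha> B, \<beta> A, \<gamma> C))"

lemma even_shape_comp: "even_shape e \<gamma> \<Longrightarrow> even_shape f \<delta> \<Longrightarrow> even_shape (e \<circ> f) (\<gamma> \<circ> \<delta>)"
  and odd_even_shape_comp: "odd_shape e \<gamma> \<Longrightarrow> even_shape f \<delta> \<Longrightarrow> odd_shape (e \<circ> f) (\<gamma> \<circ> \<delta>)"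
  and odd_shape_comp: "odd_shape e \<gamma> \<Longrightarrow> odd_shape f \<delta> \<Longrightarrow> even_shape (e \<circ> f) (\<gamma> \<circ> \<delta>)"
proof -
  show "even_shape (e \<circ> f) (\<gamma> \<circ> \<delta>)" if "even_shape e \<gamma>" "even_shape f \<delta>"
  proof -
    obtain l m \<alpha> \<beta> where e: "\<And>a b c A B C. e (a, b, c, A, B, C) = (l * a, m * b, c, \<alpha> A, \<beta> B, \<gamma> C)"
      using \<open>even_shape e \<gamma>\<close> unfolding even_shape_def by blast
    obtain l' m' \<alpha>' \<beta>' where f: "\<And>a b c A B C. f (a, b, c, A, B, C) = (l' * a, m' * b, c, \<alpha>' A, \<beta>' B, \<delta> C)"
      using \<open>even_shape f \<delta>\<close> unfolding even_shape_def by blast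
    show ?thesis unfolding even_shape_def
      by (rule exI[of _ "l * l'"], rule exI[of _ "m * m'"], rule exI[of _ "\<alpha> \<circ> \<alpha>'"],
          rule exI[of _ "\<beta> \<circ> \<beta>'"]) (simp add: e f mult.assoc)
  qed
  show "odd_shape (e \<circ> f) (\<gamma> \<circ> \<delta>)" if "odd_shape e \<gamma>" "even_shape f \<delta>"
  proof -
    obtain l m \<alpha> \<beta> where e: "\<And>a b c A B C. e (a, b, c, A, B, C) = (l * b, m * a, c, \<alpha> B, \<beta> A, \<gamma> C)"
      using \<open>odd_shape e \<gamma>\<close> unfolding odd_shape_def by blast
    obtain l' m' \<alpha>' \<beta>' where f: "\<And>a b c A B C. f (a, b, c, A, B, C) = (l' * a, m' * b, c, \<alpha>' A, \<beta>' B, \<delta> C)"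
      using \<open>even_shape f \<delta>\<close> unfolding even_shape_def by blast
    show ?thesis unfolding odd_shape_def
      by (rule exI[of _ "l * m'"], rule exI[of _ "m * l'"], rule exI[of _ "\<alpha> \<circ> \<beta>'"],
          rule exI[of _ "\<beta> \<circ> \<alpha>'"]) (simp add: e f mult.assoc)
  qed
  show "even_shape (e \<circ> f) (\<gamma> \<circ> \<delta>)" if "odd_shape e \<gamma>" "odd_shape f \<delta>"
  proof -
    obtain l m \<alpha> \<beta> where e: "\<And>a b c A B C. e (a, b, c, A, B, C) = (l * b, m * a, c, \<alpha> B, \<beta> A, \<gamma> C)"
      using \<open>odd_shape e \<gamma>\<close> unfolding odd_shape_def by blast
    obtain l' m' \<alpha>' \<beta>' where f: "\<And>a b c A B C. f (a, b, c, A, B, C) = (l' * b, m' * a, c, \<alpha>' B, \<beta>' A, \<delta> C)"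
      using \<open>odd_shape f \<delta>\<close> unfolding odd_shape_def by blast
    show ?thesis unfolding even_shape_def
      by (rule exI[of _ "l * m'"], rule exI[of _ "m * l'"], rule exI[of _ "\<alpha> \<circ> \<beta>'"],
          rule exI[of _ "\<beta> \<circ> \<alpha>'"]) (simp add: e f mult.assoc)
  qed
qed

lemma lifted_reflection_shape: "N x \<noteq> 0 \<Longrightarrow> odd_shape (lifted_reflection x) (reflection x)"
  unfolding odd_shape_def
  by (rule exI[of _ "inverse (N x)"], rule exI[of _ "N x"], rule exI[of _ "\<lambda>B. oconj x \<star> oconj B"],
      rule exI[of _ "\<lambda>A. - (inverse (N x) \<cdot> (oconj A \<star> oconj x))"])
    (simp add: lifted_reflection_apply)

lemma reflection_product_lift:
  assumes "reflection_product \<delta>"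
  shows "\<exists>e\<in>elementary. even_shape e \<delta> \<or> odd_shape e \<delta>"
  using assms
proof (induction rule: reflection_product.induct)
  case id
  have "even_shape id id" unfolding even_shape_def
    by (rule exI[of _ 1], rule exI[of _ 1], rule exI[of _ id], rule exI[of _ id]) simp
  then show ?case using elementary.elementary_id by blast
next
  case (step v \<delta>)
  then obtain e where e: "e \<in> elementary" "even_shape e \<delta> \<or> odd_shape e \<delta>" by blast
  have "lifted_reflection v \<circ> e \<in> elementary"
    by (rule elementary_comp[OF lifted_reflection_elementary e(1)])
  moreover have "even_shape (lifted_reflection v \<circ> e) (reflection v \<circ> \<delta>)
      \<or> odd_shape (lifted_reflection v \<circ> e) (reflection v \<circ> \<delta>)"
    using e(2) lifted_reflection_shape[OF step(1)] odd_even_shape_comp odd_shape_comp by blast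
  ultimately show ?case by blast
qed

section \<open>Every isometry is elementary\<close>

lemma T_omul_eqI:
  assumes "\<And>z. T (x \<star> z) = T (y \<star> z)"
  shows "x = y"
proof (rule polar_eqI)
  fix z
  show "polar N x z = polar N y z" using assms[of "oconj z"] by (simp add: T_omul)
qed

text \<open>Invariance of the determinant gives \<open>\<alpha> B \<star> \<beta> A = A \<star> B\<close>. Hence \<open>\<beta>\<close> is left multiplication by
  \<open>k = \<beta> unit\<close>, and \<open>\<alpha>\<close> is right multiplication by its inverse. Then \<open>k\<close> commutes with everything, is
  therefore scalar, and the octonions would be commutative.\<close>

lemma odd_shape_not_id:
  assumes g: "g \<in> isometries" and sh: "odd_shape g id"
  shows False
proof -
  obtain l m \<alpha> \<beta> where form: "\<And>a b c A B C. g (a, b, c, A, B, C) = (l * b, m * a, c, \<alpha> B, \<beta> A, C)"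
    using sh unfolding odd_shape_def id_apply by blast
  have T: "T ((\<alpha> B \<star> \<beta> A) \<star> C) = T ((A \<star> B) \<star> C)" for A B C
    using isometry_det[OF g, of "(0, 0, 0, A, B, C)"] by (simp add: form albert_det_apply)
  have prod: "\<alpha> B \<star> \<beta> A = A \<star> B" for A B by (rule T_omul_eqI) (rule T)
  define k where "k = \<beta> unit"
  define j where "j = \<alpha> unit"
  have "N (\<beta> A) * N (\<alpha> B) = N A * N B" for A B using prod[of B A] by (metis N_omul mult.commute)
  then have Nk: "N k \<noteq> 0" and Nj: "N j \<noteq> 0" unfolding k_def j_def
    by (metis N_unit mult_1 mult_zero_left mult_zero_right zero_neq_one)+
  have jk: "j \<star> k = unit" using prod[of unit unit] by (simp add: j_def k_def unit_left)
  have \<alpha>: "\<alpha> B \<star> k = B" for B using prod[of B unit] by (simp add: k_def unit_left)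
  have \<beta>: "j \<star> \<beta> A = A" for A using prod[of unit A] by (simp add: j_def unit_right)
  have j: "j = inverse (N k) \<cdot> oconj k"
    using omul_oconj_cancel_right[of j k] Nk by (simp add: jk unit_left)
  have \<alpha>': "\<alpha> B = inverse (N k) \<cdot> (B \<star> oconj k)" for B
    using omul_oconj_cancel_right[of "\<alpha> B" k] Nk by (simp add: \<alpha>)
  have \<beta>': "\<beta> A = k \<star> A" for A
  proof -
    have "oconj k \<star> \<beta> A = N k \<cdot> A" using \<beta>[of A] Nk unfolding j omul_scale_left
      by (metis scale_scale right_inverse scale_one)
    then have "k \<star> (oconj k \<star> \<beta> A) = N k \<cdot> (k \<star> A)" by (simp add: omul_scale_right)
    then show ?thesis using Nk by (simp add: omul_oconj_cancel_left)
  qed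
  have key: "B \<star> (k \<star> A) = A \<star> (B \<star> k)" for A B
    using prod[of "B \<star> k" A] Nk by (simp add: \<alpha>' \<beta>' omul_oconj_cancel_right)
  have "k \<star> A = A \<star> k" for A using key[of unit A] by (simp add: unit_left)
  then obtain t where t: "k = t \<cdot> unit" using commuting_imp_scalar by blast
  then have "t \<noteq> 0" using Nk by auto
  then have "B \<star> A = A \<star> B" for A B
    using key[of B A] by (simp add: t omul_scale_left omul_scale_right unit_left unit_right)
  then show False using not_commutative by blast
qed

text \<open>Invariance of the determinant gives \<open>\<alpha> A \<star> \<beta> B = A \<star> B\<close>. Hence \<open>\<alpha>\<close> is right multiplication by
  \<open>k = \<alpha> unit\<close>, \<open>\<beta>\<close> is left multiplication by its inverse, and \<open>k\<close> lies in the nucleus. For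
  \<open>k = t \<cdot> unit\<close> the map is the product of the lifted reflections of \<open>- t \<cdot> unit\<close> and \<open>unit\<close>, which
  induce the same reflection.\<close>

lemma even_shape_id_elementary:
  assumes g: "g \<in> isometries" and sh: "even_shape g id"
  shows "g \<in> elementary"
proof -
  obtain l m \<alpha> \<beta> where form: "\<And>a b c A B C. g (a, b, c, A, B, C) = (l * a, m * b, c, \<alpha> A, \<beta> B, C)"
    using sh unfolding even_shape_def id_apply by blast
  have T: "T ((\<alpha> A \<star> \<beta> B) \<star> C) = T ((A \<star> B) \<star> C)" for A B C
    using isometry_det[OF g, of "(0, 0, 0, A, B, C)"] by (simp add: form albert_det_apply)
  have prod: "\<alpha> A \<star> \<beta> B = A \<star> B" for A B by (rule T_omul_eqI) (rule T)
  define k where "k = \<alpha> unit"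
  define j where "j = \<beta> unit"
  have kj: "k \<star> j = unit" using prod[of unit unit] by (simp add: j_def k_def unit_left)
  then have "N k * N j = 1" using N_omul[of k j] by simp
  then have Nk: "N k \<noteq> 0" and Nj: "N j \<noteq> 0" by auto
  have k\<beta>: "k \<star> \<beta> B = B" for B using prod[of unit B] by (simp add: k_def unit_left)
  have \<alpha>j: "\<alpha> A \<star> j = A" for A using prod[of A unit] by (simp add: j_def unit_right)
  have j: "j = inverse (N k) \<cdot> oconj k"
    using oconj_omul_cancel_left[of k j] Nk by (simp add: kj unit_right)
  have \<alpha>: "\<alpha> A = A \<star> k" for A
  proof -
    have "\<alpha> A \<star> oconj k = N k \<cdot> A" using \<alpha>j[of A] Nk unfolding j omul_scale_right
      by (metis scale_scale right_inverse scale_one)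
    then have "(\<alpha> A \<star> oconj k) \<star> k = N k \<cdot> (A \<star> k)" by (simp add: omul_scale_left)
    then show ?thesis using Nk by (simp add: oconj_omul_cancel_right)
  qed
  have "(A \<star> k) \<star> B = A \<star> (k \<star> B)" for A B
  proof -
    have "\<beta> (k \<star> B) = B"
      using k\<beta>[of "k \<star> B"] Nk by (rule_tac omul_left_cancel[of k]) auto
    then show ?thesis using prod[of A "k \<star> B"] by (simp add: \<alpha>)
  qed
  then obtain t where t: "k = t \<cdot> unit" using nucleus_imp_scalar by blast
  then have t0: "t \<noteq> 0" using Nk by auto
  have \<alpha>t: "\<alpha> A = t \<cdot> A" for A by (simp add: \<alpha> t omul_scale_right unit_right)
  have \<beta>t: "\<beta> B = inverse t \<cdot> B" for B
    using k\<beta>[of B] t0 by (simp add: t omul_scale_left unit_left) (metis left_inverse scale_one scale_scale)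
  have "albert_det (g (1, 0, 0, unit, 0, 0)) = albert_det (1, 0, 0, unit, 0, 0)"
    "albert_det (g (0, 1, 0, 0, unit, 0)) = albert_det (0, 1, 0, 0, unit, 0)"
    by (rule isometry_det[OF g])+
  then have "l * t\<^sup>2 = 1" "m * (inverse t)\<^sup>2 = 1"
    by (simp_all add: form albert_det_apply \<alpha>t \<beta>t N_scale)
  then have lm: "l = inverse (t\<^sup>2)" "m = t\<^sup>2"
    using t0 by (simp_all add: field_simps)
  let ?h = "lifted_reflection ((- t) \<cdot> unit) \<circ> lifted_reflection unit"
  have "?h (a, b, c, A, B, C) = g (a, b, c, A, B, C)" for a b c A B C
  proof -
    have "reflection ((- t) \<cdot> unit) (reflection unit C) = C"
      using t0 reflection_scale[of "- t" unit] reflection_reflection[of unit C] by simp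
    then show ?thesis
      using t0 by (simp add: lifted_reflection_apply N_scale form lm \<alpha>t \<beta>t oconj_uminus oconj_scale
          omul_scale_left omul_scale_right omul_uminus unit_left unit_right power2_eq_square)
  qed
  then have "g = ?h" by (auto simp: fun_eq_iff)
  then show ?thesis by (simp add: elementary_comp lifted_reflection_elementary)
qed

lemma elementary_cancel:
  assumes "e \<in> elementary" "e \<circ> g \<in> elementary"
  shows "g \<in> elementary"
proof -
  obtain f where f: "f \<in> elementary" "f \<circ> e = id" using elementary_inverse[OF assms(1)] by blast
  have "f \<circ> (e \<circ> g) = g" by (simp only: f(2) comp_assoc[symmetric] id_comp)
  then show ?thesis using elementary_comp[OF f(1) assms(2)] by simp
qed

text \<open>The factor \<open>l3\<close> is inverse to the norm of an octonion, hence can be scaled to 1 by a rotated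
  product of two lifted reflections. After that \<open>\<gamma>\<close> is orthogonal, and lifted reflections reduce it to
  the identity.\<close>

lemma diagonal_elementary:
  assumes g: "g \<in> isometries"
    and ge: "g e1 = (l1, 0, 0, 0, 0, 0)" "g e2 = (0, l2, 0, 0, 0, 0)" "g e3 = (0, 0, l3, 0, 0, 0)"
  shows "g \<in> elementary"
proof -
  have main: "g \<in> elementary"
    if g: "g \<in> isometries"
      and ge: "g e1 = (l1, 0, 0, 0, 0, 0)" "g e2 = (0, l2, 0, 0, 0, 0)" "g e3 = (0, 0, 1, 0, 0, 0)"
    for g l1 l2
  proof -
    obtain \<alpha> \<beta> \<gamma> where form: "\<And>a b c A B C. g (a, b, c, A, B, C) = (l1 * a, l2 * b, 1 * c, \<alpha> A, \<beta> B, \<gamma> C)"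
      and N\<gamma>: "\<And>C. 1 * N (\<gamma> C) = N C" and lin: "Vector_Spaces.linear scale scale \<gamma>"
      using diagonal_isometry[OF g ge] by metis
    have "orthogonal \<gamma>" using N\<gamma> lin by (simp add: orthogonal_def)
    then obtain \<delta> where \<delta>: "reflection_product \<delta>" "\<delta> \<circ> \<gamma> = id"
      using orthogonal_imp_reflection_product by blast
    then obtain e where e: "e \<in> elementary" "even_shape e \<delta> \<or> odd_shape e \<delta>"
      using reflection_product_lift by blast
    have eg: "e \<circ> g \<in> isometries" by (intro isometry_comp elementary_isometry e g)
    have "even_shape g \<gamma>" unfolding even_shape_def
      by (rule exI[of _ l1], rule exI[of _ l2], rule exI[of _ \<alpha>], rule exI[of _ \<beta>]) (simp add: form)
    then have "even_shape (e \<circ> g) id \<or> odd_shape (e \<circ> g) id"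
      using e(2) even_shape_comp odd_even_shape_comp \<delta>(2) by metis
    then have "e \<circ> g \<in> elementary"
      using odd_shape_not_id[OF eg] even_shape_id_elementary[OF eg] by blast
    then show ?thesis by (rule elementary_cancel[OF e(1)])
  qed
  obtain \<gamma> where l: "l3 * N (\<gamma> unit) = 1"
    using diagonal_isometry[OF g ge] by (metis N_unit)
  let ?x = "\<gamma> unit"
  have "N ?x \<noteq> 0" using l by auto
  then have Nx: "N ?x \<noteq> 0" "l3 = inverse (N ?x)" using l by (simp_all add: field_simps)
  \<comment> \<open>Rotating twice turns this into an element that multiplies \<open>e3\<close> by the inverse of \<open>l3\<close>.\<close>
  let ?h = "lifted_reflection ?x \<circ> lifted_reflection unit"
  have he: "?h e1 = (inverse (N ?x), 0, 0, 0, 0, 0)" "?h e2 = (0, N ?x, 0, 0, 0, 0)" "?h e3 = e3"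
    using Nx(1) by (simp_all add: lifted_reflection_apply reflection_def)
  have "?h \<in> elementary" by (intro elementary_comp lifted_reflection_elementary)
  then obtain h' where h': "h' \<in> elementary" "\<And>v. rot (?h v) = h' (rot v)"
    using elementary_rot by blast
  then obtain h where h: "h \<in> elementary" "\<And>v. rot (h' v) = h (rot v)"
    using elementary_rot by blast
  have he': "h e2 = (0, inverse (N ?x), 0, 0, 0, 0)" "h e3 = (0, 0, N ?x, 0, 0, 0)" "h e1 = e1"
    using h'(2)[of e1] h'(2)[of e2] h'(2)[of e3] h(2)[of "rot e1"] h(2)[of "rot e2"] h(2)[of "rot e3"]
      he unfolding rot_apply by (metis rot_apply)+
  have hg: "h \<circ> g \<in> isometries" by (intro isometry_comp elementary_isometry h g)
  have sc: "h (albert_scale k v) = albert_scale k (h v)" for k v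
    by (intro isometry_scale elementary_isometry h)
  have "(h \<circ> g) e1 = (l1, 0, 0, 0, 0, 0)"
    using sc[of l1 e1] he' by (simp add: ge)
  moreover have "(h \<circ> g) e2 = (0, l2 * inverse (N ?x), 0, 0, 0, 0)"
    using sc[of l2 e2] he' by (simp add: ge)
  moreover have "(h \<circ> g) e3 = (0, 0, 1, 0, 0, 0)"
    using sc[of l3 e3] he' Nx by (simp add: ge)
  ultimately have "h \<circ> g \<in> elementary" by (rule main[OF hg])
  then show ?thesis by (rule elementary_cancel[OF h(1)])
qed

text \<open>The idempotents are treated one after the other. The root elements for \<open>e2\<close> fix \<open>e1\<close>, those for
  \<open>e3\<close> fix \<open>e1\<close> and \<open>e2\<close>. The value \<open>tri e1 e2 e3 = 1\<close> guarantees a nonzero pivot each time.\<close>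

theorem isometry_elementary:
  assumes g: "g \<in> isometries"
  shows "g \<in> elementary"
proof -
  have white_e3: "white e3"
    using white_isometry[OF rot_isometry white_e1] unfolding rot_apply .
  have white_e2: "white e2"
    using white_isometry[OF rot_isometry white_e3] unfolding rot_apply .
  obtain e l1 where e: "e \<in> elementary" "l1 \<noteq> 0" "e (g e1) = (l1, 0, 0, 0, 0, 0)"
    using white_reach1[OF white_isometry[OF g white_e1]] by (elim bexE exE conjE)
  define g1 where "g1 = e \<circ> g"
  have g1: "g1 \<in> isometries" unfolding g1_def by (intro isometry_comp elementary_isometry e g)
  have g1e: "g1 e1 = (l1, 0, 0, 0, 0, 0)" by (simp add: g1_def e)
  obtain a b c A B C where v: "g1 e2 = (a, b, c, A, B, C)" by (cases "g1 e2")
  have "tri (g1 e1) (g1 e2) (g1 e3) = 1" by (simp add: tri_isometry[OF g1] tri_eq)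
  then have bcA: "b \<noteq> 0 \<or> c \<noteq> 0 \<or> A \<noteq> 0"
    by (cases "g1 e3") (auto simp: g1e v tri_eq)
  obtain f l2 where f: "f \<in> elementary" "f e1 = e1" "l2 \<noteq> 0" "f (g1 e2) = (0, l2, 0, 0, 0, 0)"
    using white_reach2[OF white_isometry[OF g1 white_e2, unfolded v] bcA, folded v]
    by (elim bexE exE conjE)
  define g2 where "g2 = f \<circ> g1"
  have g2: "g2 \<in> isometries" unfolding g2_def by (intro isometry_comp elementary_isometry f g1)
  have g2e: "g2 e1 = (l1, 0, 0, 0, 0, 0)" "g2 e2 = (0, l2, 0, 0, 0, 0)"
    using isometry_scale[OF elementary_isometry[OF f(1)], of l1 e1] by (simp_all add: g2_def f g1e)
  obtain a b c A B C where v: "g2 e3 = (a, b, c, A, B, C)" by (cases "g2 e3")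
  have "tri (g2 e1) (g2 e2) (g2 e3) = 1" by (simp add: tri_isometry[OF g2] tri_eq)
  then have c: "c \<noteq> 0" by (auto simp: g2e v tri_eq)
  define h where "h = root13 (- (inverse c \<cdot> B)) \<circ> root23 (- (inverse c \<cdot> A))"
  have h: "h \<in> elementary" unfolding h_def by (intro elementary_comp root_elementary)
  have he: "h e1 = e1" "h e2 = e2" by (simp_all only: h_def comp_apply root_fixes)
  note hs = isometry_scale[OF elementary_isometry[OF h]]
  have "h \<circ> g2 \<in> elementary"
  proof (rule diagonal_elementary)
    show "h \<circ> g2 \<in> isometries" by (intro isometry_comp elementary_isometry h g2)
    show "(h \<circ> g2) e1 = (l1, 0, 0, 0, 0, 0)" using hs[of l1 e1] he by (simp add: g2e)
    show "(h \<circ> g2) e2 = (0, l2, 0, 0, 0, 0)" using hs[of l2 e2] he by (simp add: g2e)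
    show "(h \<circ> g2) e3 = (0, 0, c, 0, 0, 0)"
      unfolding h_def comp_apply v by (rule white_reduce3[OF white_isometry[OF g2 white_e3, unfolded v] c])
  qed
  then have "g2 \<in> elementary" by (rule elementary_cancel[OF h])
  then have "g1 \<in> elementary" unfolding g2_def by (rule elementary_cancel[OF f(1)])
  then show ?thesis unfolding g1_def by (rule elementary_cancel[OF e(1)])
qed

section \<open>The stabilizer of a white point\<close>

lemma SE6_inv:
  assumes "g \<in> isometries" "h \<in> isometries" "h \<circ> g = id"
  shows "inv\<^bsub>SE6\<^esub> g = h"
  using group.inv_equality[OF group_SE6, of h g] assms by (simp add: SE6_mult SE6_one)

definition line_stabilizer :: "(('f, 'o) albert \<Rightarrow> ('f, 'o) albert) set" where
  "line_stabilizer = {g \<in> isometries. \<exists>l. g e1 = albert_scale l e1}"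

lemma line_stabilizer_inverse:
  assumes g: "g \<in> line_stabilizer" and h: "h \<in> isometries" "h \<circ> g = id"
  shows "h \<in> line_stabilizer"
proof -
  obtain l where l: "g e1 = albert_scale l e1" and gi: "g \<in> isometries"
    using g unfolding line_stabilizer_def by blast
  have hg: "h (g v) = v" for v using h(2) by (metis comp_apply id_apply)
  have e: "e1 = albert_scale l (h e1)" using hg[of e1] unfolding l isometry_scale[OF h(1)] by simp
  obtain a b c A B C where he: "h e1 = (a, b, c, A, B, C)" by (cases "h e1")
  have "h e1 = albert_scale a e1" using e unfolding he by auto
  then show ?thesis unfolding line_stabilizer_def using h(1) by blast
qed

lemma subgroup_line_stabilizer: "subgroup line_stabilizer SE6"
proof
  show "line_stabilizer \<subseteq> carrier SE6" unfolding line_stabilizer_def by blast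
  have "id e1 = albert_scale 1 e1" by simp
  then show "\<one>\<^bsub>SE6\<^esub> \<in> line_stabilizer"
    unfolding SE6_one line_stabilizer_def using isometry_id by blast
  fix g assume g: "g \<in> line_stabilizer"
  then have gi: "g \<in> isometries" unfolding line_stabilizer_def by blast
  obtain h where h: "h \<in> isometries" "h \<circ> g = id" using isometry_inverse[OF gi] by blast
  show "inv\<^bsub>SE6\<^esub> g \<in> line_stabilizer"
    unfolding SE6_inv[OF gi h] by (rule line_stabilizer_inverse[OF g h])
  fix f assume f: "f \<in> line_stabilizer"
  then have fi: "f \<in> isometries" unfolding line_stabilizer_def by blast
  obtain l m where "g e1 = albert_scale l e1" "f e1 = albert_scale m e1"
    using f g unfolding line_stabilizer_def by blast
  then have "(g \<circ> f) e1 = albert_scale (m * l) e1"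
    by (simp only: comp_apply isometry_scale[OF gi]) simp
  then show "g \<otimes>\<^bsub>SE6\<^esub> f \<in> line_stabilizer"
    unfolding SE6_mult line_stabilizer_def using isometry_comp[OF gi fi] by blast
qed

lemma line_stabilizerI: "g \<in> isometries \<Longrightarrow> g e1 = (l, 0, 0, 0, 0, 0) \<Longrightarrow> g \<in> line_stabilizer"
  unfolding line_stabilizer_def by (intro CollectI conjI exI[of _ l]) simp_all

text \<open>Let \<open>m\<close> in \<open>M\<close> move the line of \<open>e1\<close>. If \<open>m e1\<close> is opposite to \<open>e1\<close>, root elements fixing \<open>e1\<close> bring
  it to a multiple of \<open>e2\<close>; then \<open>flip\<close> lies in \<open>M\<close>, which with the roots fixing \<open>e1\<close> generates
  everything. Otherwise they bring it to a vector \<open>w\<close> with the single entry \<open>C\<close>. For nonisotropic \<open>x\<close>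
  orthogonal to \<open>C\<close> the element \<open>root21 x\<close> fixes \<open>w\<close>, hence lies in \<open>M\<close>, and maps \<open>e1\<close> to an
  opposite vector.\<close>

lemma line_stabilizer_maximal:
  assumes sub: "subgroup M SE6" and PM: "line_stabilizer \<subseteq> M"
  shows "M \<subseteq> line_stabilizer \<or> M = carrier SE6"
proof (cases "M \<subseteq> line_stabilizer")
  case False
  have M_iso: "M \<subseteq> isometries" by (rule subgroup.subset[OF sub])
  have M_comp: "g \<circ> h \<in> M" if "g \<in> M" "h \<in> M" for g h
    using subgroup.m_closed[OF sub that] by (simp only: SE6_mult)
  have M_inv: "\<exists>h\<in>M. h \<circ> g = id \<and> g \<circ> h = id" if "g \<in> M" for g
  proof -
    have gi: "g \<in> isometries" using that M_iso by blast
    obtain h where h: "h \<in> isometries" "g \<circ> h = id" "h \<circ> g = id" using isometry_inverse[OF gi] by blast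
    then have "h \<in> M" using subgroup.m_inv_closed[OF sub that] SE6_inv[OF gi h(1) h(3)] by simp
    then show ?thesis using h by blast
  qed
  have P: "g \<in> M" if "g \<in> isometries" "g e1 = (l, 0, 0, 0, 0, 0)" for g l
    using PM line_stabilizerI[OF that] by blast
  \<comment> \<open>The root elements fixing \<open>e1\<close> and their conjugates under \<open>flip\<close> are all the root elements.\<close>
  have flip: "M = carrier SE6" if f: "flip \<in> M"
  proof -
    have fixing: "root12 x \<in> M" "root13 x \<in> M" "root23 x \<in> M" "root32 x \<in> M" for x
      by (rule P[OF root_isometry(1) root_fixes(1)] P[OF root_isometry(6) root_fixes(2)]
          P[OF root_isometry(3) root_fixes(3)] P[OF root_isometry(4) root_fixes(4)])+
    have "root21 x \<in> M" "root31 x \<in> M" for x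
      unfolding root21_flip root31_flip by (intro M_comp f fixing)+
    then have roots: "r \<in> M" if "r \<in> roots" for r
      using that fixing by (elim roots_cases) simp_all
    have "e \<in> M" if "e \<in> elementary" for e
      using that
    proof (induction rule: elementary.induct)
      case elementary_id
      show ?case by (rule P[OF isometry_id, of 1]) simp
    next
      case (elementary_step r e)
      then show ?case using M_comp roots by blast
    qed
    then show ?thesis using isometry_elementary M_iso by blast
  qed
  have opposite: "M = carrier SE6" if m: "m \<in> M" "m e1 = (0, l, 0, 0, 0, 0)" for m l
  proof -
    obtain m' where m': "m' \<in> M" "m' \<circ> m = id" "m \<circ> m' = id" using M_inv[OF m(1)] by blast
    have "flip \<circ> m \<in> isometries"
      by (rule isometry_comp[OF flip_isometry subsetD[OF M_iso m(1)]])
    then have "flip \<circ> m \<in> M" by (rule P[of _ l]) (simp add: m(2))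
    then have "(flip \<circ> m) \<circ> m' \<in> M" using m' M_comp by blast
    then have "flip \<in> M" by (simp only: comp_assoc m'(3) comp_id)
    then show ?thesis by (rule flip)
  qed
  have generic: "M = carrier SE6"
    if m: "m \<in> M" "m e1 = (a, b, c, A, B, C)" and bcA: "b \<noteq> 0 \<or> c \<noteq> 0 \<or> A \<noteq> 0" for m a b c A B C
  proof -
    have w: "white (m e1)" by (rule white_isometry[OF subsetD[OF M_iso m(1)] white_e1])
    obtain e l where e: "e \<in> elementary" "e e1 = e1" "e (m e1) = (0, l, 0, 0, 0, 0)"
      using white_reach2[OF w[unfolded m(2)] bcA, folded m(2)] by (elim bexE exE conjE)
    have "e \<in> M" using P[OF elementary_isometry[OF e(1)] e(2)] .
    then have "e \<circ> m \<in> M" by (rule M_comp[OF _ m(1)])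
    then show ?thesis by (rule opposite[of _ l]) (simp only: comp_apply e(3))
  qed
  have special: "M = carrier SE6" if m: "m \<in> M" "m e1 = (0, 0, 0, 0, 0, C)" for m C
  proof -
    obtain x where x: "N x \<noteq> 0" "polar N x C = 0" using exists_nonisotropic_perp3[of C] by blast
    obtain m' where m': "m' \<in> M" "m' \<circ> m = id" "m \<circ> m' = id" using M_inv[OF m(1)] by blast
    have mm: "m' (m v) = v" for v using m'(2) by (metis comp_apply id_apply)
    have "root21 x (m e1) = m e1" using x by (simp add: m(2) root_apply)
    then have "(m' \<circ> (root21 x \<circ> m)) e1 = e1" by (simp only: comp_apply mm)
    moreover have "m' \<circ> (root21 x \<circ> m) \<in> isometries"
      by (intro isometry_comp root_isometry subsetD[OF M_iso] m'(1) m(1))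
    ultimately have "m' \<circ> (root21 x \<circ> m) \<in> M" by (intro P)
    then have "m \<circ> (m' \<circ> (root21 x \<circ> m)) \<circ> m' \<in> M" using M_comp m(1) m'(1) by blast
    also have "m \<circ> (m' \<circ> (root21 x \<circ> m)) \<circ> m' = root21 x"
      by (simp only: comp_assoc m'(3) comp_id) (simp only: comp_assoc[symmetric] m'(3) id_comp)
    finally show ?thesis by (rule generic[where b = "N x"]) (use x in \<open>simp_all add: root_apply\<close>)
  qed
  have nongeneric: "M = carrier SE6" if m: "m \<in> M" "m e1 = (a, 0, 0, 0, B, C)" and C: "C \<noteq> 0" for m a B C
  proof -
    obtain y where y: "polar N C y = 1" using exists_polar_eq_1[OF C] by blast
    have r12: "root12 x \<in> M" and r32: "root32 x \<in> M" for x
      using P[OF root_isometry(1) root_fixes(1)] P[OF root_isometry(4) root_fixes(4)] by blast+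
    let ?m1 = "root12 (- (a \<cdot> y)) \<circ> m"
    have m1: "?m1 e1 = (0, 0, 0, 0, B, C)"
      using y by (simp add: m(2) root_apply polar_uminus polar_scale_left polar_commute[of y C])
    have m1M: "?m1 \<in> M" using M_comp r12 m(1) by blast
    \<comment> \<open>Whiteness of this vector forces \<open>B\<close> to be a multiple of \<open>oconj C\<close>, which a root element
      fixing \<open>e1\<close> can then subtract. The octonion \<open>y\<close> makes the second diagonal entry 1, so that the
      coordinates after row reduction can be compared.\<close>
    have "white (?m1 e1)" by (rule white_isometry[OF subsetD[OF M_iso m1M] white_e1])
    then have "white (root21 y (?m1 e1))" by (rule white_isometry[OF root_isometry(2)])
    then have w: "white (0, 1, 0, oconj y \<star> oconj B, B, C)"
      unfolding m1 root_apply by (simp add: y polar_commute[of y C])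
    have B: "B - (B \<star> y) \<star> oconj C = 0"
      using white_reduce2[OF w] by (simp add: root_apply oconj_uminus oconj_omul omul_uminus)
    let ?m2 = "root32 (- oconj (B \<star> y)) \<circ> ?m1"
    have "?m2 e1 = (0, 0, 0, 0, 0, C)"
      unfolding comp_apply[of "root32 _"] m1 using B by (simp add: root_apply oconj_uminus omul_uminus)
    moreover have "?m2 \<in> M" using M_comp r32 m1M by blast
    ultimately show ?thesis by (intro special)
  qed
  obtain m where m: "m \<in> M" "m \<notin> line_stabilizer" using False by blast
  have mi: "m \<in> isometries" using m(1) M_iso by blast
  obtain a b c A B C where me: "m e1 = (a, b, c, A, B, C)" by (cases "m e1")
  consider "b \<noteq> 0 \<or> c \<noteq> 0 \<or> A \<noteq> 0" | "b = 0" "c = 0" "A = 0" "C \<noteq> 0"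
    | "b = 0" "c = 0" "A = 0" "C = 0" by blast
  then have "M = carrier SE6"
  proof cases
    case 1
    then show ?thesis by (rule generic[OF m(1) me])
  next
    case 2
    show ?thesis by (rule nongeneric[OF m(1) _ 2(4)]) (simp only: me 2)
  next
    case 3
    then have B: "B \<noteq> 0" using line_stabilizerI[OF mi, of a] m(2) me by auto
    then have B': "oconj B \<noteq> 0" by (metis oconj_oconj oconj_zero)
    have "root23 unit \<in> M" using P[OF root_isometry(3) root_fixes(3)] by blast
    then have "root23 unit \<circ> m \<in> M" using M_comp m(1) by blast
    moreover have "(root23 unit \<circ> m) e1 = (a, 0, 0, 0, B, oconj B)"
      using 3 by (simp add: me root_apply unit_right)
    ultimately show ?thesis using B' by (rule nongeneric)
  qed
  then show ?thesis ..
qed blast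

section \<open>The unipotent radical\<close>

text \<open>The isometries that act trivially on the three layers of the flag of the line of \<open>e1\<close>, the radical
  \<open>rad e1\<close> and the whole space. The description makes invariance under the stabilizer of the line
  evident.\<close>

definition unipotent :: "(('f, 'o) albert \<Rightarrow> ('f, 'o) albert) set" where
  "unipotent = {g \<in> isometries. g e1 = e1 \<and> (\<forall>v. g v - v \<in> rad e1)
     \<and> (\<forall>v\<in>rad e1. \<exists>t. g v - v = albert_scale t e1)}"

lemma mem_rad_e1: "(a, b, c, A, B, C) \<in> rad e1 \<longleftrightarrow> b = 0 \<and> c = 0 \<and> A = 0"
proof
  assume "(a, b, c, A, B, C) \<in> rad e1"
  then have D: "tri e1 (a, b, c, A, B, C) w = 0" for w unfolding rad_def by blast
  have "A = 0" by (rule polar_nondegenerate) (use D[of "(0, 0, 0, _, 0, 0)"] in \<open>simp add: tri_eq\<close>)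
  then show "b = 0 \<and> c = 0 \<and> A = 0" using D[of e2] D[of e3] by (simp add: tri_eq)
next
  assume "b = 0 \<and> c = 0 \<and> A = 0"
  then have "tri e1 (a, b, c, A, B, C) w = 0" for w by (cases w) (simp add: tri_eq)
  then show "(a, b, c, A, B, C) \<in> rad e1" unfolding rad_def by blast
qed

lemma tri_scale: "tri (albert_scale k u) v w = k * tri u v w"
  by (cases u; cases v; cases w)
    (simp add: tri_eq polar_scale_left omul_scale_left omul_scale_right T_scale algebra_simps)

lemma line_stabilizer_rad:
  assumes p: "p \<in> line_stabilizer" and v: "v \<in> rad e1"
  shows "p v \<in> rad e1"
proof -
  have pi: "p \<in> isometries" using p unfolding line_stabilizer_def by blast
  obtain q where q: "q \<in> isometries" "p \<circ> q = id" "q \<circ> p = id" using isometry_inverse[OF pi] by blast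
  have pq: "p (q w) = w" for w using q(2) by (metis comp_apply id_apply)
  have "q \<in> line_stabilizer" by (rule line_stabilizer_inverse[OF p q(1,3)])
  then obtain l where l: "q e1 = albert_scale l e1" unfolding line_stabilizer_def by blast
  have "tri e1 (p v) w = 0" for w
  proof -
    have "tri (p (q e1)) (p v) (p (q w)) = tri (q e1) v (q w)" by (rule tri_isometry[OF pi])
    also have "\<dots> = l * tri e1 v (q w)" by (simp only: l tri_scale)
    also have "tri e1 v (q w) = 0" using v unfolding rad_def by blast
    finally show ?thesis by (simp only: pq mult_zero_right)
  qed
  then show ?thesis unfolding rad_def by blast
qed

lemma unipotent_conj:
  assumes p: "p \<in> line_stabilizer" and q: "q \<in> isometries" "p \<circ> q = id" "q \<circ> p = id"
    and u: "u \<in> unipotent"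
  shows "p \<circ> u \<circ> q \<in> unipotent"
proof -
  have pi: "p \<in> isometries" using p unfolding line_stabilizer_def by blast
  have ui: "u \<in> isometries" and ue: "u e1 = e1" and u1: "\<And>v. u v - v \<in> rad e1"
    and u2: "\<And>v. v \<in> rad e1 \<Longrightarrow> \<exists>t. u v - v = albert_scale t e1"
    using u unfolding unipotent_def by blast+
  have pq: "p (q w) = w" for w using q(2) by (metis comp_apply id_apply)
  have qP: "q \<in> line_stabilizer" by (rule line_stabilizer_inverse[OF p q(1,3)])
  obtain l where l: "q e1 = albert_scale l e1" using qP unfolding line_stabilizer_def by blast
  obtain m where m: "p e1 = albert_scale m e1" using p unfolding line_stabilizer_def by blast
  have diff: "(p \<circ> u \<circ> q) v - v = p (u (q v) - q v)" for v
    by (simp only: comp_apply isometry_diff[OF pi] pq)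
  have "p \<circ> u \<circ> q \<in> isometries" by (intro isometry_comp pi ui q)
  moreover have "(p \<circ> u \<circ> q) e1 = e1"
  proof -
    have "u (q e1) = q e1" by (simp only: l isometry_scale[OF ui] ue)
    then show ?thesis by (simp only: comp_apply pq)
  qed
  moreover have "(p \<circ> u \<circ> q) v - v \<in> rad e1" for v
    unfolding diff by (rule line_stabilizer_rad[OF p u1])
  moreover have "\<exists>t. (p \<circ> u \<circ> q) v - v = albert_scale t e1" if vr: "v \<in> rad e1" for v
  proof -
    obtain t where t: "u (q v) - q v = albert_scale t e1"
      using u2[OF line_stabilizer_rad[OF qP vr]] by blast
    have "(p \<circ> u \<circ> q) v - v = albert_scale (t * m) e1"
      unfolding diff t isometry_scale[OF pi] m by simp
    then show ?thesis by blast
  qed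
  ultimately show ?thesis unfolding unipotent_def by blast
qed

lemma root_unipotent: "root12 x \<in> unipotent" "root13 x \<in> unipotent"
proof -
  have d: "root12 x (a, b, c, A, B, C) - (a, b, c, A, B, C)
      = (b * N x + polar N x C, 0, 0, 0, oconj A \<star> oconj x, b \<cdot> x)"
    "root13 x (a, b, c, A, B, C) - (a, b, c, A, B, C)
      = (c * N x + polar N x B, 0, 0, 0, c \<cdot> x, oconj x \<star> oconj A)" for a b c A B C
    by (simp_all add: root_apply)
  have "root12 x v - v \<in> rad e1" "root13 x v - v \<in> rad e1" for v
    by (cases v, simp only: d mem_rad_e1 simp_thms)+
  moreover have "\<exists>t. root12 x v - v = albert_scale t e1" "\<exists>t. root13 x v - v = albert_scale t e1"
    if "v \<in> rad e1" for v
  proof -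
    obtain a B C where v: "v = (a, 0, 0, 0, B, C)" using \<open>v \<in> rad e1\<close> by (cases v) (simp add: mem_rad_e1)
    show "\<exists>t. root12 x v - v = albert_scale t e1"
      unfolding v d by (rule exI[of _ "polar N x C"]) simp
    show "\<exists>t. root13 x v - v = albert_scale t e1"
      unfolding v d by (rule exI[of _ "polar N x B"]) simp
  qed
  ultimately show "root12 x \<in> unipotent" "root13 x \<in> unipotent"
    unfolding unipotent_def using root_isometry root_fixes by blast+
qed

lemma root_commute: "root13 y (root12 x v) = root12 x (root13 y v)"
proof -
  have "polar N x (oconj y \<star> oconj A) = polar N y (oconj A \<star> oconj x)" for A
    using polar_omul_adjoint_left[of y x "oconj A"] polar_omul_adjoint_right[of y x "oconj A"]
    by (simp add: polar_commute)
  then show ?thesis by (cases v) (simp add: root_apply polar_add_right algebra_simps)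
qed

text \<open>An element of the radical moves \<open>e2\<close> and \<open>e3\<close> by vectors of \<open>rad e1\<close>. Two root elements move them
  back, and the result is diagonal and trivial on each layer of the flag.\<close>

lemma unipotent_eq_roots:
  assumes g: "g \<in> unipotent"
  shows "\<exists>x y. g = root12 x \<circ> root13 y"
proof -
  have gi: "g \<in> isometries" and ge: "g e1 = e1" and g1: "\<And>v. g v - v \<in> rad e1"
    and g2: "\<And>v. v \<in> rad e1 \<Longrightarrow> \<exists>t. g v - v = albert_scale t e1"
    using g unfolding unipotent_def by blast+
  have white_e3: "white e3"
    using white_isometry[OF rot_isometry white_e1] unfolding rot_apply .
  have white_e2: "white e2"
    using white_isometry[OF rot_isometry white_e3] unfolding rot_apply .
  have form: "\<exists>p Y Z. g (a, b, c, A, B, C) = (p, b, c, A, Y, Z)" for a b c A B C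
    using g1[of "(a, b, c, A, B, C)"] by (cases "g (a, b, c, A, B, C)") (simp add: mem_rad_e1)
  have form': "\<exists>p. g (a, 0, 0, 0, B, C) = (p, 0, 0, 0, B, C)" for a B C
    using g2[of "(a, 0, 0, 0, B, C)"] by (cases "g (a, 0, 0, 0, B, C)") (simp add: mem_rad_e1)
  obtain p Y Z where g_e2: "g e2 = (p, 1, 0, 0, Y, Z)" using form by blast
  obtain p' Y' Z' where g_e3: "g e3 = (p', 0, 1, 0, Y', Z')" using form by blast
  have e2': "root12 (- Z) (g e2) = e2"
    using white_reduce2[OF white_isometry[OF gi white_e2, unfolded g_e2]] by (simp add: g_e2)
  define q where "q = p' + polar N (- Z) Z'"
  have g_e3': "root12 (- Z) (g e3) = (q, 0, 1, 0, Y', Z')" by (simp add: g_e3 root_apply q_def)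
  have w3: "white (q, 0, 1, 0, Y', Z')"
    using white_isometry[OF root_isometry(1) white_isometry[OF gi white_e3]] unfolding g_e3'[symmetric] .
  have e3': "root13 (- Y') (q, 0, 1, 0, Y', Z') = e3"
    using white_reduce3[OF w3] by simp
  define h where "h = root13 (- Y') \<circ> root12 (- Z) \<circ> g"
  have hi: "h \<in> isometries" unfolding h_def by (intro isometry_comp root_isometry gi)
  have h1: "h e1 = (1, 0, 0, 0, 0, 0)" by (simp only: h_def comp_apply ge root_fixes)
  have h2: "h e2 = (0, 1, 0, 0, 0, 0)" by (simp only: h_def comp_apply e2' root_fixes)
  have h3: "h e3 = (0, 0, 1, 0, 0, 0)" by (simp only: h_def comp_apply g_e3' e3')
  obtain \<alpha> \<beta> \<gamma> where h: "\<And>a b c A B C. h (a, b, c, A, B, C) = (1 * a, 1 * b, 1 * c, \<alpha> A, \<beta> B, \<gamma> C)"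
    using diagonal_isometry[OF hi h1 h2 h3] by metis
  have "\<alpha> A = A" for A
  proof -
    obtain p Y Z where "g (0, 0, 0, A, 0, 0) = (p, 0, 0, A, Y, Z)" using form by blast
    then show ?thesis using h[of 0 0 0 A 0 0] by (simp add: h_def root_apply)
  qed
  moreover have "\<beta> B = B" "\<gamma> B = B" for B
  proof -
    obtain p where "g (0, 0, 0, 0, B, B) = (p, 0, 0, 0, B, B)" using form' by blast
    then show "\<beta> B = B" "\<gamma> B = B" using h[of 0 0 0 0 B B] by (simp_all add: h_def root_apply)
  qed
  ultimately have hv: "h v = v" for v by (cases v) (simp add: h)
  have "g v = root12 Z (root13 Y' v)" for v
  proof -
    have "root12 Z (root13 Y' (h v)) = g v"
      by (simp add: h_def root_add del: split_paired_All)
    then show ?thesis by (simp only: hv)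
  qed
  then have "g = root12 Z \<circ> root13 Y'" by (simp add: fun_eq_iff del: split_paired_All)
  then show ?thesis by blast
qed

lemma unipotent_commute:
  assumes "u \<in> unipotent" "v \<in> unipotent"
  shows "u \<circ> v = v \<circ> u"
proof -
  obtain x y x' y' where "u = root12 x \<circ> root13 y" "v = root12 x' \<circ> root13 y'"
    using unipotent_eq_roots assms by metis
  then show ?thesis
    by (simp only: fun_eq_iff comp_apply root_commute root_add add.commute) simp
qed

section \<open>Simplicity\<close>

text \<open>A Steinberg relation with one argument equal to \<open>unit\<close>. It makes root elements commutators over
  every field, including the fields with two and three elements.\<close>

lemma root12_commutator:
  "root12 (oconj y) v = root13 y (root32 unit (root13 (- y) (root32 (- unit) v)))"
proof -
  obtain a b c A B C where v: "v = (a, b, c, A, B, C)" by (cases v)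
  let ?c = "c + b - T A" and ?A = "A - b \<cdot> unit" and ?B = "B - oconj C"
  let ?C = "C - oconj y \<star> oconj ?A"
  have 1: "root32 (- unit) v = (a, b, ?c, ?A, ?B, C)"
    by (simp add: v root_apply polar_uminus polar_unit oconj_uminus omul_uminus unit_left)
  have 2: "root13 (- y) (a, b, ?c, ?A, ?B, C) =
      (a + ?c * N y - polar N y ?B, b, ?c, ?A, ?B - ?c \<cdot> y, ?C)"
    by (simp add: root_apply polar_uminus oconj_uminus omul_uminus)
  have c: "oconj ?C = oconj C - ?A \<star> y" by (simp add: oconj_diff oconj_omul)
  have B: "?B - ?c \<cdot> y + oconj ?C = B - c \<cdot> y + oconj A \<star> y"
    unfolding c
    by (simp add: oconj_def[of A] omul_diff_left omul_scale_left unit_left scale_left_distrib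
        scale_left_diff_distrib)
  have 3: "root32 unit (a + ?c * N y - polar N y ?B, b, ?c, ?A, ?B - ?c \<cdot> y, ?C) =
      (a + ?c * N y - polar N y ?B, b, c, A, B - c \<cdot> y + oconj A \<star> y, ?C)"
  proof -
    have "?c + b * N unit + polar N unit ?A = c" by (simp add: polar_unit T_diff T_scale)
    then show ?thesis unfolding root_apply using B by (simp add: unit_left)
  qed
  have "polar N y (oconj A \<star> y) = N y * T A"
    using polar_omul_right_same[of unit y "oconj A"] by (simp add: unit_left polar_unit mult.commute)
  moreover have "polar N y (oconj C) = polar N (oconj y) C" by (simp add: polar_oconj_swap)
  ultimately have a: "a + ?c * N y - polar N y ?B + c * N y + polar N y (B - c \<cdot> y + oconj A \<star> y)
      = a + b * N y + polar N (oconj y) C"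
    by (simp add: polar_diff_right polar_add_right polar_scale_right polar_self algebra_simps)
  have C: "?C + oconj y \<star> oconj A = C + b \<cdot> oconj y"
    by (simp add: oconj_diff oconj_scale omul_diff_right omul_scale_right unit_right)
  have "root13 y (a + ?c * N y - polar N y ?B, b, c, A, B - c \<cdot> y + oconj A \<star> y, ?C) =
      root12 (oconj y) v"
    unfolding v root_apply a C by simp
  then show ?thesis by (simp only: 1 2 3)
qed

lemma normal_conj:
  assumes H: "H \<lhd> SE6" and h: "h \<in> H" and g: "g \<in> isometries" "g' \<in> isometries" "g' \<circ> g = id"
  shows "g \<circ> h \<circ> g' \<in> H"
  using normal.inv_op_closed2[OF H g(1) h] by (simp only: SE6_inv[OF g] SE6_mult)

lemma normal_contains_roots:
  assumes H: "H \<lhd> SE6" and r: "\<And>x. root12 x \<in> H"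
  shows "H = carrier SE6"
proof -
  have sub: "subgroup H SE6" by (rule normal_imp_subgroup[OF H])
  have rr: "rot \<circ> rot \<in> isometries" "(rot \<circ> rot) \<circ> rot = id" "flip \<circ> flip = id"
    by (rule isometry_comp[OF rot_isometry rot_isometry]) (simp_all add: fun_eq_iff)
  have rot: "f \<in> H" if "e \<in> H" "\<And>v. rot (e v) = f (rot v)" for e f
  proof -
    have "f v = rot (e (rot (rot v)))" for v by (simp only: that(2) rot_rot_rot)
    then have "f = rot \<circ> e \<circ> (rot \<circ> rot)" by (simp add: fun_eq_iff)
    then show ?thesis using normal_conj[OF H that(1) rot_isometry rr(1,2)] by simp
  qed
  have 31: "root31 x \<in> H" for x by (rule rot[OF r]) (rule root_rot)
  have 23: "root23 x \<in> H" for x by (rule rot[OF 31]) (rule root_rot)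
  have 21: "root21 x \<in> H" for x
    unfolding root21_flip by (rule normal_conj[OF H r flip_isometry flip_isometry rr(3)])
  have 13: "root13 x \<in> H" for x by (rule rot[OF 21]) (rule root_rot)
  have 32: "root32 x \<in> H" for x by (rule rot[OF 13]) (rule root_rot)
  have roots: "s \<in> H" if "s \<in> roots" for s
    using that by (rule roots_cases) (simp_all only: r 21 23 32 31 13)
  have "e \<in> H" if "e \<in> elementary" for e
    using that
  proof (induction rule: elementary.induct)
    case elementary_id
    show ?case using subgroup.one_closed[OF sub] by (simp only: SE6_one)
  next
    case (elementary_step s e)
    then show ?case using subgroup.m_closed[OF sub roots, of s e] by (simp only: SE6_mult)
  qed
  then show ?thesis using subgroup.subset[OF sub] isometry_elementary by blast
qed

lemma normal_contains_commutators:
  assumes H: "H \<lhd> SE6"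
    and comm: "\<And>u v g. u \<in> unipotent \<Longrightarrow> v \<in> unipotent \<Longrightarrow> g \<in> carrier SE6 \<Longrightarrow>
      u \<otimes>\<^bsub>SE6\<^esub> (g \<otimes>\<^bsub>SE6\<^esub> v \<otimes>\<^bsub>SE6\<^esub> inv\<^bsub>SE6\<^esub> g) \<otimes>\<^bsub>SE6\<^esub> inv\<^bsub>SE6\<^esub> u
        \<otimes>\<^bsub>SE6\<^esub> inv\<^bsub>SE6\<^esub> (g \<otimes>\<^bsub>SE6\<^esub> v \<otimes>\<^bsub>SE6\<^esub> inv\<^bsub>SE6\<^esub> g) \<in> H"
  shows "H = carrier SE6"
proof (rule normal_contains_roots[OF H])
  fix x
  let ?y = "oconj x"
  have rr: "rot \<circ> rot \<in> isometries" "(rot \<circ> rot) \<circ> rot = id"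
    by (rule isometry_comp[OF rot_isometry rot_isometry]) (simp add: fun_eq_iff)
  have "(rot \<circ> root13 unit \<circ> (rot \<circ> rot)) v = root32 unit v" for v
    by (simp only: comp_apply root_rot rot_rot_rot)
  then have r32: "rot \<circ> root13 unit \<circ> (rot \<circ> rot) = root32 unit" by (rule ext)
  have i13: "inv\<^bsub>SE6\<^esub> (root13 ?y) = root13 (- ?y)"
    by (rule SE6_inv[OF root_isometry(6) root_isometry(6)]) (simp add: fun_eq_iff root_add del: split_paired_All)
  have i32: "inv\<^bsub>SE6\<^esub> (root32 unit) = root32 (- unit)"
    by (rule SE6_inv[OF root_isometry(4) root_isometry(4)]) (simp add: fun_eq_iff root_add del: split_paired_All)
  have "root13 ?y \<circ> root32 unit \<circ> root13 (- ?y) \<circ> root32 (- unit) \<in> H"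
    using comm[OF root_unipotent(2)[of ?y] root_unipotent(2)[of unit] rot_isometry]
    by (simp only: SE6_mult SE6_inv[OF rot_isometry rr] r32 i13 i32)
  moreover have "root13 ?y \<circ> root32 unit \<circ> root13 (- ?y) \<circ> root32 (- unit) = root12 x"
    using root12_commutator[of ?y] by (simp add: fun_eq_iff del: split_paired_All)
  ultimately show "root12 x \<in> H" by simp
qed

text \<open>Fixing the lines of the idempotents makes \<open>k\<close> diagonal. The images of the idempotents under root
  elements are white vectors with two diagonal entries and one octonion entry, and they tie all the
  factors together: \<open>k\<close> is a scalar, and isometries are linear.\<close>

lemma fixes_white_points_imp_central:
  assumes k: "k \<in> isometries"
    and fix_pts: "\<And>g. g \<in> isometries \<Longrightarrow> \<exists>l. k (g e1) = albert_scale l (g e1)"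
  shows "k \<in> centre SE6"
proof -
  have rr: "rot \<circ> rot \<in> isometries" by (rule isometry_comp[OF rot_isometry rot_isometry])
  obtain l1 l2 l3 where "k (id e1) = albert_scale l1 (id e1)"
    "k ((rot \<circ> rot) e1) = albert_scale l2 ((rot \<circ> rot) e1)" "k (rot e1) = albert_scale l3 (rot e1)"
    using fix_pts[OF isometry_id] fix_pts[OF rr] fix_pts[OF rot_isometry] by blast
  then have ke: "k e1 = (l1, 0, 0, 0, 0, 0)" "k e2 = (0, l2, 0, 0, 0, 0)" "k e3 = (0, 0, l3, 0, 0, 0)"
    by simp_all
  obtain \<alpha> \<beta> \<gamma> where form:
    "\<And>a b c A B C. k (a, b, c, A, B, C) = (l1 * a, l2 * b, l3 * c, \<alpha> A, \<beta> B, \<gamma> C)"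
    using diagonal_isometry[OF k ke] by metis
  have 21: "l2 * N x = l1 * N x \<and> \<gamma> x = l1 \<cdot> x" for x
  proof -
    obtain l where "k (root21 x e1) = albert_scale l (root21 x e1)"
      using fix_pts[OF root_isometry(2)] by blast
    then show ?thesis by (simp add: root_apply form)
  qed
  have 31: "l3 * N x = l1 * N x \<and> \<beta> x = l1 \<cdot> x" for x
  proof -
    obtain l where "k (root31 x e1) = albert_scale l (root31 x e1)"
      using fix_pts[OF root_isometry(5)] by blast
    then show ?thesis by (simp add: root_apply form)
  qed
  have l: "l2 = l1" "l3 = l1" using 21[of unit] 31[of unit] by simp_all
  have 32: "\<alpha> x = l1 \<cdot> x" for x
  proof -
    obtain l where "k ((root32 x \<circ> (rot \<circ> rot)) e1) = albert_scale l ((root32 x \<circ> (rot \<circ> rot)) e1)"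
      using fix_pts[OF isometry_comp[OF root_isometry(4) rr]] by blast
    then show ?thesis by (simp add: root_apply form l)
  qed
  have kv: "k v = albert_scale l1 v" for v by (cases v) (simp add: form l 32 31 21)
  have "k \<circ> g = g \<circ> k" if "g \<in> isometries" for g
  proof
    fix v
    show "(k \<circ> g) v = (g \<circ> k) v" by (simp only: comp_apply kv isometry_scale[OF that])
  qed
  then show ?thesis unfolding centre_def SE6_mult using k by blast
qed

text \<open>A normal subgroup inside one point stabilizer lies in all of them, because the conjugate by \<open>g\<close>
  stabilizes the image under \<open>g\<close> of the line of \<open>e1\<close>.\<close>

lemma normal_subgroup_SE6:
  assumes K: "K \<lhd> SE6"
  shows "K \<subseteq> centre SE6 \<or> K = carrier SE6"
proof -
  have unipotent_iso: "unipotent \<subseteq> carrier SE6" unfolding unipotent_def by blast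
  have "K \<subseteq> line_stabilizer \<or> K = carrier SE6"
  proof (rule group.iwasawa[OF group_SE6 subgroup_line_stabilizer line_stabilizer_maximal
        unipotent_iso _ _ normal_contains_commutators K])
    show "u \<otimes>\<^bsub>SE6\<^esub> v = v \<otimes>\<^bsub>SE6\<^esub> u" if "u \<in> unipotent" "v \<in> unipotent" for u v
      unfolding SE6_mult by (rule unipotent_commute[OF that])
    show "p \<otimes>\<^bsub>SE6\<^esub> u \<otimes>\<^bsub>SE6\<^esub> inv\<^bsub>SE6\<^esub> p \<in> unipotent" if p: "p \<in> line_stabilizer" and u: "u \<in> unipotent" for p u
    proof -
      have pi: "p \<in> isometries" using p unfolding line_stabilizer_def by blast
      obtain q where q: "q \<in> isometries" "p \<circ> q = id" "q \<circ> p = id" using isometry_inverse[OF pi] by blast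
      show ?thesis unfolding SE6_mult SE6_inv[OF pi q(1,3)] by (rule unipotent_conj[OF p q u])
    qed
  qed
  moreover have "K \<subseteq> centre SE6" if KP: "K \<subseteq> line_stabilizer"
  proof
    fix k assume k: "k \<in> K"
    show "k \<in> centre SE6"
    proof (rule fixes_white_points_imp_central)
      show "k \<in> isometries" using k KP unfolding line_stabilizer_def by blast
      fix g assume g: "g \<in> isometries"
      obtain h where h: "h \<in> isometries" "g \<circ> h = id" "h \<circ> g = id" using isometry_inverse[OF g] by blast
      have "h \<circ> k \<circ> g \<in> K" by (rule normal_conj[OF K k h(1) g h(2)])
      then obtain l where "(h \<circ> k \<circ> g) e1 = albert_scale l e1"
        using KP unfolding line_stabilizer_def by blast
      then have "g (h (k (g e1))) = albert_scale l (g e1)"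
        by (simp only: comp_apply isometry_scale[OF g])
      moreover have "g (h v) = v" for v using h(2) by (metis comp_apply id_apply)
      ultimately have "k (g e1) = albert_scale l (g e1)" by (simp only:)
      then show "\<exists>l. k (g e1) = albert_scale l (g e1)" by blast
    qed
  qed
  ultimately show ?thesis by blast
qed

lemma flip_not_central: "flip \<notin> centre SE6"
proof
  assume "flip \<in> centre SE6"
  then have "flip \<circ> rot = rot \<circ> flip" unfolding centre_def SE6_mult using rot_isometry by blast
  then have "flip (rot e1) = rot (flip e1)" by (metis comp_apply)
  then show False by simp
qed

theorem simple_E6: "simple_abstract_group E6"
  unfolding E6_def
proof (rule group.simple_mod_centre[OF group_SE6 _ normal_subgroup_SE6])
  show "\<exists>x\<in>carrier SE6. x \<notin> centre SE6" using flip_isometry flip_not_central by blast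
qed

end

theorem theorem10p4:
  fixes scale :: "'f::field \<Rightarrow> 'o::ab_group_add \<Rightarrow> 'o"
    and omul :: "'o \<Rightarrow> 'o \<Rightarrow> 'o"
    and unit :: 'o
    and N :: "'o \<Rightarrow> 'f"
  assumes "octonion_algebra scale omul unit N"
  shows "simple_abstract_group (octonion_algebra.E6 scale omul unit N)"
  by (rule octonion_algebra.simple_E6[OF assms])

end
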